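(* For every integer $n \geq 5$ there exists a convex body $K \subset \mathbb{R}^n$ with centroid at the origin, $c(K)=0$, such that $$\langle c(K \cap \xi^{\perp}), e_n \rangle \geq 0 \quad \text{for every } \xi \in S^{n-1},$$ with equality if and only if $\xi = \pm e_n$, where $e_n = (0,\ldots,0,1)$.
   Context: A convex body in $\mathbb{R}^n$ is a compact convex set with non-empty interior. The centroid of a convex body $K\subset\mathbb{R}^n$ is $c(K) = \frac{1}{|K|}\int_K x\,dx$, where integration is with respect to Lebesgue measure and $|K|$ denotes the volume of $K$. $S^{n-1}$ is the Euclidean unit sphere in $\mathbb{R}^n$, $\langle\cdot,\cdot\rangle$ is the standard inner product, and for $\xi\in S^{n-1}$, $\xi^\perp = \{x\in\mathbb{R}^n : \langle x,\xi\rangle = 0\}$. For a section $K\cap\xi^\perp$, the centroid $c(K\cap \xi^\perp) = \frac{1}{|K\cap\xi^\perp|}\int_{K\cap\xi^\perp} x\,dx$ is taken with respect to $(n-1)$-dimensional Lebesgue measure on $\xi^\perp$, with $|K\cap\xi^\perp|$ the $(n-1)$-dimensional volume. *)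

theory Defs
  imports "HOL-Analysis.Analysis"
begin

definition convex_body :: "'a::euclidean_space set \<Rightarrow> bool" where
  "convex_body K \<longleftrightarrow> compact K \<and> convex K \<and> interior K \<noteq> {}"

definition orthonormal_basis_of :: "'a::euclidean_space set \<Rightarrow> 'a set \<Rightarrow> bool" where
  "orthonormal_basis_of S B \<longleftrightarrow>
     pairwise orthogonal B \<and> (\<forall>b\<in>B. norm b = 1) \<and> span B = S"

lemma orthonormal_basis_of_exists:
  assumes "subspace S"
  shows "\<exists>B. orthonormal_basis_of S B"
  using orthonormal_basis_subspace[OF assms] unfolding orthonormal_basis_of_def by metis

(* The dim S-dimensional Lebesgue measure on a linear subspace S, as a Borel measure on the
   ambient space concentrated on S. This is the library's definition of lborel with Basis
   replaced by an orthonormal basis of S; the measure does not depend on the chosen basis,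
   because Lebesgue measure is invariant under orthogonal maps. *)
definition subspace_lborel :: "'a::euclidean_space set \<Rightarrow> 'a measure" where
  "subspace_lborel S =
     (let B = (SOME B. orthonormal_basis_of S B)
      in distr (\<Pi>\<^sub>M b\<in>B. lborel) borel (\<lambda>f. \<Sum>b\<in>B. f b *\<^sub>R b))"

definition centroid :: "'a::euclidean_space measure \<Rightarrow> 'a set \<Rightarrow> 'a" where
  "centroid M K = (1 / measure M K) *\<^sub>R (LINT x:K|M. x)"

definition perp :: "'a::euclidean_space \<Rightarrow> 'a set" where
  "perp \<xi> = {x. x \<bullet> \<xi> = 0}"

end

theory Submission
  imports Defs
begin

text \<open>
  Take the body of revolution $K = \{x : -a \le x_n \le b, |x'| \le r(x_n)\}$ with $r$ concave.
  In dimension $n = m + 2$, up to positive factors, the last coordinate of its centroid is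
  $\int_{-a}^b t\, r(t)^{m+1} dt$, and that of the centroid of the section by $\xi^\perp$ is
  $F(u) = \int_{-a}^b t\, (r(t)^2 - u t^2)_+^{m/2} dt$, where $u \ge 0$ is $\cot^2$ of the angle
  between $\xi$ and $e_n$.

  Perturb the cylinder $r = 1$ on $[-1, 1]$ to $r(t) = 1 + \epsilon (t - \kappa t_+^3)$ on
  $[-1, 1 + \epsilon\beta]$. To first order, $F(u)$ becomes
  $m \int_0^1 t (2t - \kappa t^3) (1 - u t^2)_+^{m/2-1} dt + \beta (1 - u)_+^{m/2}$
  and the centroid becomes $(m + 1) \int_0^1 t (2t - \kappa t^3) dt + \beta$.
  For $\kappa = 10/3$ and $\beta = 0$ the latter vanishes, and so does the former at $u = 0$; for
  $u > 0$ the former is positive, because $2t - \kappa t^3$ changes sign once and the weight is decreasing; this uses $m > 2$.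
  Raising $\kappa$ a little and taking $\beta$ slightly below the value that balances the
  centroid makes the centroid negative and $F$ positive for all $u \ge 0$. Cutting off a slice at the
  left end then brings the centroid back to $0$ and only increases $F$.
\<close>

section \<open>Lebesgue measure in orthonormal coordinates\<close>

text \<open>The measure inside \<open>subspace_lborel\<close> with the basis as a parameter, so that
  a basis adapted to the body of revolution can replace the one that \<open>SOME\<close>
  picks.\<close>

definition onb_lborel :: "'a::euclidean_space set \<Rightarrow> 'a measure" where
  "onb_lborel B = distr (\<Pi>\<^sub>M b\<in>B. lborel) borel (\<lambda>f. \<Sum>b\<in>B. f b *\<^sub>R b)"

lemma sets_onb_lborel [simp, measurable_cong]: "sets (onb_lborel B) = sets borel"
  and space_onb_lborel [simp]: "space (onb_lborel B) = UNIV"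
  by (auto simp: onb_lborel_def)

section \<open>Expansions in an orthonormal family\<close>

lemma orthonormal_finite:
  fixes B :: "'a::euclidean_space set"
  assumes "pairwise orthogonal B" "\<And>b. b \<in> B \<Longrightarrow> norm b = 1"
  shows "finite B" "independent B"
  using assms pairwise_orthogonal_independent[OF assms(1)] independent_imp_finite
  by (metis norm_zero zero_neq_one)+

lemma span_orthonormal_card:
  fixes B :: "'a::euclidean_space set"
  assumes "pairwise orthogonal B" "\<And>b. b \<in> B \<Longrightarrow> norm b = 1" "span B = UNIV"
  shows "card B = DIM('a)"
  using orthonormal_finite[OF assms(1,2)] assms(3)
  by (auto simp flip: dim_UNIV dim_span_eq_card_independent)

lemma sum_orthonormal_inner:
  fixes B :: "'a::euclidean_space set"
  assumes "pairwise orthogonal B" "\<And>b. b \<in> B \<Longrightarrow> norm b = 1" "c \<in> B"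
  shows "(\<Sum>b\<in>B. f b *\<^sub>R b) \<bullet> c = f c"
proof -
  have fin: "finite B" using orthonormal_finite assms by blast
  have "(\<Sum>b\<in>B. f b *\<^sub>R b) \<bullet> c = (\<Sum>b\<in>B. f b * (b \<bullet> c))"
    by (simp add: inner_sum_left)
  also have "\<dots> = (\<Sum>b\<in>B. if b = c then f c else 0)"
    using assms by (intro sum.cong) (auto simp: pairwise_def orthogonal_def norm_eq_1)
  also have "\<dots> = f c" using fin assms by simp
  finally show ?thesis .
qed

lemma sum_orthonormal_norm:
  fixes B :: "'a::euclidean_space set"
  assumes "pairwise orthogonal B" "\<And>b. b \<in> B \<Longrightarrow> norm b = 1"
  shows "norm (\<Sum>b\<in>B. f b *\<^sub>R b) = sqrt (\<Sum>b\<in>B. (f b)\<^sup>2)"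
proof -
  have "(\<Sum>b\<in>B. f b *\<^sub>R b) \<bullet> (\<Sum>c\<in>B. f c *\<^sub>R c) = (\<Sum>c\<in>B. f c * ((\<Sum>b\<in>B. f b *\<^sub>R b) \<bullet> c))"
    by (simp add: inner_sum_right)
  also have "\<dots> = (\<Sum>b\<in>B. (f b)\<^sup>2)"
    using sum_orthonormal_inner[OF assms] by (intro sum.cong) (auto simp: power2_eq_square)
  finally show ?thesis by (simp add: norm_eq_sqrt_inner)
qed

lemma sum_orthonormal_expand:
  fixes B :: "'a::euclidean_space set"
  assumes "pairwise orthogonal B" "\<And>b. b \<in> B \<Longrightarrow> norm b = 1" "x \<in> span B"
  shows "(\<Sum>b\<in>B. (x \<bullet> b) *\<^sub>R b) = x"
proof -
  have fin: "finite B" using orthonormal_finite assms by blast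
  obtain f where f: "x = (\<Sum>b\<in>B. f b *\<^sub>R b)"
    using assms(3) span_finite[OF fin] by auto
  show ?thesis
    unfolding f by (intro sum.cong refl) (simp add: sum_orthonormal_inner[OF assms(1,2)])
qed

section \<open>Product coordinates and the volume of balls\<close>

interpretation lborel_product: product_sigma_finite "\<lambda>_::'i. lborel :: real measure"
  by standard

lemma emeasure_onb_lborel:
  assumes "A \<in> sets borel"
  shows "emeasure (onb_lborel B) A =
    emeasure (\<Pi>\<^sub>M b\<in>B. lborel) {f \<in> space (\<Pi>\<^sub>M b\<in>B. lborel). (\<Sum>b\<in>B. f b *\<^sub>R b) \<in> A}"
  unfolding onb_lborel_def using assms
  by (subst emeasure_distr) (auto intro!: arg_cong[where f = "emeasure _"])

lemma emeasure_onb_lborel_nn_integral: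
  assumes [measurable]: "A \<in> sets borel"
  shows "emeasure (onb_lborel B) A = (\<integral>\<^sup>+ f. indicator A (\<Sum>b\<in>B. f b *\<^sub>R b) \<partial>(\<Pi>\<^sub>M b\<in>B. lborel))"
proof -
  have "emeasure (onb_lborel B) A = (\<integral>\<^sup>+ x. indicator A x \<partial>onb_lborel B)"
    by simp
  then show ?thesis unfolding onb_lborel_def by (subst (asm) nn_integral_distr) auto
qed

text \<open>Serves to recentre balls, because \<open>emeasure_cball_aux\<close> computes only
  volumes of balls about the origin.\<close>

lemma PiM_lborel_translation:
  fixes c :: "'i \<Rightarrow> real"
  assumes "finite I"
  shows "distr (\<Pi>\<^sub>M i\<in>I. lborel) (\<Pi>\<^sub>M i\<in>I. lborel) (\<lambda>f. \<lambda>i\<in>I. f i + c i) = (\<Pi>\<^sub>M i\<in>I. lborel)"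
proof (rule lborel_product.PiM_eqI[OF assms])
  fix A :: "'i \<Rightarrow> real set" assume A: "\<And>i. i \<in> I \<Longrightarrow> A i \<in> sets lborel"
  have [measurable]: "(\<lambda>f. \<lambda>i\<in>I. f i + c i) \<in> (\<Pi>\<^sub>M i\<in>I. lborel) \<rightarrow>\<^sub>M (\<Pi>\<^sub>M i\<in>I. lborel)"
    by measurable
  have "(\<lambda>f. \<lambda>i\<in>I. f i + c i) -` Pi\<^sub>E I A \<inter> space (\<Pi>\<^sub>M i\<in>I. lborel) =
        Pi\<^sub>E I (\<lambda>i. (\<lambda>x. x + c i) -` A i)"
    by (auto simp: space_PiM PiE_iff extensional_def)
  then have "emeasure (distr (\<Pi>\<^sub>M i\<in>I. lborel) (\<Pi>\<^sub>M i\<in>I. lborel) (\<lambda>f. \<lambda>i\<in>I. f i + c i)) (Pi\<^sub>E I A)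
      = emeasure (\<Pi>\<^sub>M i\<in>I. lborel) (Pi\<^sub>E I (\<lambda>i. (\<lambda>x. x + c i) -` A i))"
    using A assms by (subst emeasure_distr) (auto intro!: sets_PiM_I_finite)
  also have "\<dots> = (\<Prod>i\<in>I. emeasure lborel ((\<lambda>x. x + c i) -` A i))"
    using A by (intro lborel_product.emeasure_PiM assms)
      (auto intro: measurable_sets_borel[of _ borel])
  also have "\<dots> = (\<Prod>i\<in>I. emeasure lborel (A i))"
  proof (intro prod.cong refl)
    fix i assume "i \<in> I"
    have "emeasure lborel (A i) = emeasure (distr lborel borel ((+) (c i))) (A i)"
      by (simp add: lborel_distr_plus)
    also have "\<dots> = emeasure lborel ((\<lambda>x. x + c i) -` A i)"
      using A[OF \<open>i \<in> I\<close>] by (subst emeasure_distr) (auto simp: add.commute[of _ "c i"])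
    finally show "emeasure lborel ((\<lambda>x. x + c i) -` A i) = emeasure lborel (A i)" by simp
  qed
  finally show "emeasure (distr (\<Pi>\<^sub>M i\<in>I. lborel) (\<Pi>\<^sub>M i\<in>I. lborel) (\<lambda>f. \<lambda>i\<in>I. f i + c i)) (Pi\<^sub>E I A)
     = (\<Prod>i\<in>I. emeasure lborel (A i))" .
qed simp

text \<open>In orthonormal coordinates the ball becomes a Euclidean ball of the coordinate space.
  Moved to the origin, its volume depends only on \<open>r\<close> and \<open>card B\<close>, and
  \<open>card B\<close> is the dimension of the space.\<close>

lemma emeasure_onb_lborel_cball:
  fixes B :: "'a::euclidean_space set"
  assumes B: "pairwise orthogonal B" "\<And>b. b \<in> B \<Longrightarrow> norm b = 1" "span B = UNIV" and "r > 0"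
  shows "emeasure (onb_lborel B) (cball c r) = emeasure lborel (cball c r)"
proof -
  let ?P = "\<Pi>\<^sub>M b\<in>B. lborel :: real measure"
  have fin: "finite B" using orthonormal_finite[OF B(1,2)] by simp
  have card: "card B = DIM('a)" by (rule span_orthonormal_card[OF B])
  let ?S = "{f. sqrt (\<Sum>b\<in>B. (f b)\<^sup>2) \<le> r} \<inter> space ?P"
  have [measurable]: "?S \<in> sets ?P" by measurable
  have "emeasure (onb_lborel B) (cball c r) =
      emeasure ?P {f \<in> space ?P. sqrt (\<Sum>b\<in>B. (f b + - (c \<bullet> b))\<^sup>2) \<le> r}"
  proof (subst emeasure_onb_lborel)
    have "dist c (\<Sum>b\<in>B. f b *\<^sub>R b) = sqrt (\<Sum>b\<in>B. (f b + - (c \<bullet> b))\<^sup>2)" for f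
    proof -
      have "dist c (\<Sum>b\<in>B. f b *\<^sub>R b) = norm ((\<Sum>b\<in>B. f b *\<^sub>R b) - (\<Sum>b\<in>B. (c \<bullet> b) *\<^sub>R b))"
        using sum_orthonormal_expand[OF B(1,2), of c] B(3) by (simp add: dist_norm norm_minus_commute)
      also have "\<dots> = norm (\<Sum>b\<in>B. (f b - (c \<bullet> b)) *\<^sub>R b)"
        by (simp add: sum_subtractf scaleR_diff_left)
      finally show ?thesis using sum_orthonormal_norm[OF B(1,2)] by simp
    qed
    then show "emeasure ?P {f \<in> space ?P. (\<Sum>b\<in>B. f b *\<^sub>R b) \<in> cball c r} =
        emeasure ?P {f \<in> space ?P. sqrt (\<Sum>b\<in>B. (f b + - (c \<bullet> b))\<^sup>2) \<le> r}"
      by simp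
  qed auto
  also have "\<dots> = emeasure (distr ?P ?P (\<lambda>f. \<lambda>b\<in>B. f b + - (c \<bullet> b))) ?S"
    by (subst emeasure_distr[OF _ \<open>?S \<in> sets ?P\<close>])
      (auto simp: space_PiM intro!: arg_cong[where f = "emeasure _"])
  also have "\<dots> = emeasure ?P ?S"
    by (simp only: PiM_lborel_translation[OF fin])
  also have "\<dots> = emeasure lborel (cball c r)"
    using emeasure_cball_aux[OF fin \<open>r > 0\<close>] \<open>r > 0\<close> card by (simp add: emeasure_cball)
  finally show ?thesis .
qed

text \<open>Agreement on balls suffices by Vitali's theorem, which fills an open set with
  disjoint balls up to a Lebesgue null set. The possible defect on that null set is excluded by
  applying the inequality also to a ball minus a box.\<close>

lemma emeasure_lborel_open_le:
  fixes M :: "'a::euclidean_space measure"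
  assumes sets [measurable_cong]: "sets M = sets borel"
    and balls: "\<And>c r. r > 0 \<Longrightarrow> emeasure M (cball c r) = emeasure lborel (cball c r)"
    and "open U"
  shows "emeasure lborel U \<le> emeasure M U"
proof -
  define K where "K = {i :: 'a \<times> real. snd i > 0 \<and> cball (fst i) (snd i) \<subseteq> U}"
  obtain C where C: "countable C" "C \<subseteq> K"
     "pairwise (\<lambda>i j. disjnt (cball (fst i) (snd i)) (cball (fst j) (snd j))) C"
     "negligible (U - (\<Union>i \<in> C. cball (fst i) (snd i)))"
  proof (rule Vitali_covering_theorem_cballs[of K snd U fst])
    show "0 < snd i" if "i \<in> K" for i using that by (simp add: K_def)
    fix x d assume "x \<in> U" "0 < (d::real)"
    then obtain e where e: "e > 0" "cball x e \<subseteq> U" using \<open>open U\<close> open_contains_cball by blast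
    let ?r = "min e (d / 2)"
    have "(x, ?r) \<in> K" "x \<in> cball x ?r" "?r < d"
      using e \<open>0 < d\<close> by (auto simp: K_def)
    then show "\<exists>i. i \<in> K \<and> x \<in> cball (fst i) (snd i) \<and> snd i < d"
      by (intro exI[of _ "(x, ?r)"]) auto
  qed
  let ?V = "\<Union>i \<in> C. cball (fst i) (snd i)"
  have sub: "?V \<subseteq> U" using C(2) by (auto simp: K_def)
  have [measurable]: "U \<in> sets borel" using \<open>open U\<close> by simp
  have [measurable]: "?V \<in> sets borel" using C(1) by (intro sets.countable_UN') auto
  have disj: "disjoint_family_on (\<lambda>i. cball (fst i) (snd i)) C"
    using C(3) unfolding pairwise_def disjoint_family_on_def disjnt_def by blast
  have "U - ?V \<in> null_sets lborel"
    using C(4) by (simp add: negligible_iff_null_sets null_sets_completion_iff)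
  then have "emeasure lborel U = emeasure lborel ?V"
    using sub emeasure_Un_null_set[of ?V lborel "U - ?V"] by (simp add: Un_absorb1)
  also have "\<dots> = (\<integral>\<^sup>+ i. emeasure lborel (cball (fst i) (snd i)) \<partial>count_space C)"
    using C(1) disj by (intro emeasure_UN_countable) auto
  also have "\<dots> = (\<integral>\<^sup>+ i. emeasure M (cball (fst i) (snd i)) \<partial>count_space C)"
    using C(2) by (intro nn_integral_cong) (auto simp: K_def balls)
  also have "\<dots> = emeasure M ?V"
    using C(1) disj by (intro emeasure_UN_countable[symmetric]) (auto simp: sets)
  also have "\<dots> \<le> emeasure M U"
    using sub by (intro emeasure_mono) (auto simp: sets)
  finally show ?thesis .
qed

lemma lborel_eqI_cball:
  fixes M :: "'a::euclidean_space measure"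
  assumes sets: "sets M = sets borel"
    and balls: "\<And>c r. r > 0 \<Longrightarrow> emeasure M (cball c r) = emeasure lborel (cball c r)"
  shows "lborel = M"
proof (rule lborel_eqI)
  fix l u :: 'a assume lu: "\<And>b. b \<in> Basis \<Longrightarrow> l \<bullet> b \<le> u \<bullet> b"
  note le = emeasure_lborel_open_le[OF sets balls]
  obtain R where R: "R > 0" "cbox l u \<subseteq> ball 0 R"
    using bounded_subset_ballD[OF bounded_cbox] by blast
  have fin: "emeasure lborel (ball 0 R - cbox l u) \<noteq> \<infinity>"
    using emeasure_lborel_ball_finite[of 0 R] emeasure_mono[of "ball 0 R - cbox l u" "ball (0::'a) R" lborel]
    by (auto dest: le_less_trans)
  \<comment> \<open>The two measures agree on closed balls, so a lower bound for \<open>M\<close> on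
    the open set \<open>ball 0 R - cbox l u\<close> is an upper bound for \<open>M\<close> on the
    box. The Lebesgue measure of that set is finite and can be cancelled.\<close>
  have "emeasure M (cbox l u) + emeasure lborel (ball 0 R - cbox l u)
      \<le> emeasure M (cbox l u) + emeasure M (ball 0 R - cbox l u)"
    by (intro add_mono order_refl le open_Diff) auto
  also have "\<dots> = emeasure M (ball 0 R)"
    using R by (subst plus_emeasure) (auto simp: sets Un_absorb1)
  also have "\<dots> \<le> emeasure M (cball 0 R)" by (intro emeasure_mono) (auto simp: sets)
  also have "\<dots> = emeasure lborel (ball (0::'a) R)"
    using R by (simp add: balls emeasure_cball emeasure_ball)
  also have "\<dots> = emeasure lborel (cbox l u) + emeasure lborel (ball 0 R - cbox l u)"
    using R by (subst plus_emeasure) (auto simp: Un_absorb1)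
  finally have "emeasure M (cbox l u) \<le> emeasure lborel (cbox l u)"
    using fin
    by (simp add: add.commute[of _ "emeasure lborel (ball 0 R - cbox l u)"] ennreal_add_left_cancel_le top_unique)
  have "emeasure M (box l u) \<le> emeasure M (cbox l u)"
    by (intro emeasure_mono box_subset_cbox) (auto simp: sets)
  also have "\<dots> \<le> emeasure lborel (cbox l u)" by fact
  also have "\<dots> = emeasure lborel (box l u)"
    using lu by (simp add: emeasure_lborel_box emeasure_lborel_cbox)
  finally have "emeasure M (box l u) = emeasure lborel (box l u)"
    using le[of "box l u"] by (simp add: open_box antisym)
  then show "emeasure M (box l u) = (\<Prod>b\<in>Basis. (u - l) \<bullet> b)"
    using lu by (simp add: emeasure_lborel_box)
qed (fact sets)

lemma onb_lborel_eq_lborel: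
  fixes B :: "'a::euclidean_space set"
  assumes "pairwise orthogonal B" "\<And>b. b \<in> B \<Longrightarrow> norm b = 1" "span B = UNIV"
  shows "onb_lborel B = lborel"
  using lborel_eqI_cball[of "onb_lborel B"] emeasure_onb_lborel_cball[OF assms] by simp

text \<open>The extra coordinate along \<xi> in \<open>[0, 1]\<close> turns the measure of a subset of \<xi>'s
  orthogonal complement into the measure of a slab, so that independence of the basis reduces to
  the full-dimensional case.\<close>

lemma emeasure_onb_lborel_insert:
  fixes B :: "'a::euclidean_space set"
  assumes B: "pairwise orthogonal (insert \<xi> B)" "\<And>b. b \<in> insert \<xi> B \<Longrightarrow> norm b = 1" "\<xi> \<notin> B"
    and [measurable]: "A \<in> sets borel"
  shows "emeasure (onb_lborel B) A =
    emeasure (onb_lborel (insert \<xi> B)) {x. x \<bullet> \<xi> \<in> {0..1} \<and> x - (x \<bullet> \<xi>) *\<^sub>R \<xi> \<in> A}"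
proof -
  let ?P = "\<lambda>B::'a set. \<Pi>\<^sub>M b\<in>B. lborel :: real measure"
  have fin: "finite B" using orthonormal_finite[OF B(1,2)] by simp
  let ?A' = "{x. x \<bullet> \<xi> \<in> {0..1} \<and> x - (x \<bullet> \<xi>) *\<^sub>R \<xi> \<in> A}"
  have [measurable]: "?A' \<in> sets borel" by measurable
  have A': "(\<Sum>b\<in>insert \<xi> B. f b *\<^sub>R b) \<in> ?A' \<longleftrightarrow> f \<xi> \<in> {0..1} \<and> (\<Sum>b\<in>B. f b *\<^sub>R b) \<in> A" for f
    using sum_orthonormal_inner[OF B(1,2), of \<xi> f] fin B(3) by simp
  have "emeasure (onb_lborel (insert \<xi> B)) ?A' =
      (\<integral>\<^sup>+ f. indicator {0..1} (f \<xi>) * indicator A (\<Sum>b\<in>B. f b *\<^sub>R b) \<partial>?P (insert \<xi> B))"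
    unfolding emeasure_onb_lborel_nn_integral[OF \<open>?A' \<in> sets borel\<close>]
    by (intro nn_integral_cong) (use A' in \<open>auto simp only: indicator_def of_bool_conj\<close>)
  also have "\<dots> = (\<integral>\<^sup>+ f. (\<integral>\<^sup>+ y. indicator {0..1} ((f(\<xi> := y)) \<xi>) *
      indicator A (\<Sum>b\<in>B. (f(\<xi> := y)) b *\<^sub>R b) \<partial>lborel) \<partial>?P B)"
    using fin B(3) by (intro lborel_product.product_nn_integral_insert) auto
  also have "\<dots> = (\<integral>\<^sup>+ f. (\<integral>\<^sup>+ y. indicator {0..1::real} y * indicator A (\<Sum>b\<in>B. f b *\<^sub>R b) \<partial>lborel) \<partial>?P B)"
  proof -
    have "(\<Sum>b\<in>B. (f(\<xi> := y)) b *\<^sub>R b) = (\<Sum>b\<in>B. f b *\<^sub>R b)" for f :: "'a \<Rightarrow> real" and y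
      using B(3) by (intro sum.cong) auto
    then show ?thesis by (simp only: fun_upd_same)
  qed
  also have "\<dots> = (\<integral>\<^sup>+ f. indicator A (\<Sum>b\<in>B. f b *\<^sub>R b) \<partial>?P B)"
    by (simp add: nn_integral_multc)
  also have "\<dots> = emeasure (onb_lborel B) A"
    by (simp add: emeasure_onb_lborel_nn_integral)
  finally show ?thesis by simp
qed

section \<open>Lebesgue measure on a hyperplane through the origin\<close>

lemma orthonormal_basis_of_perp:
  assumes "norm \<xi> = 1" and B: "orthonormal_basis_of (perp \<xi>) B"
  shows "pairwise orthogonal (insert \<xi> B)" "\<And>b. b \<in> insert \<xi> B \<Longrightarrow> norm b = 1" "\<xi> \<notin> B"
    "span (insert \<xi> B) = UNIV"
proof -
  have sub: "B \<subseteq> perp \<xi>" using B span_superset by (auto simp: orthonormal_basis_of_def)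
  then have orth: "b \<bullet> \<xi> = 0" if "b \<in> B" for b using that by (auto simp: perp_def)
  then show "pairwise orthogonal (insert \<xi> B)"
    using B by (auto simp: orthonormal_basis_of_def pairwise_insert orthogonal_def inner_commute)
  show "norm b = 1" if "b \<in> insert \<xi> B" for b
    using that assms by (auto simp: orthonormal_basis_of_def)
  show "\<xi> \<notin> B" using orth[of \<xi>] assms(1) by auto
  have "x - (x \<bullet> \<xi>) *\<^sub>R \<xi> \<in> span B" for x
  proof -
    have "x - (x \<bullet> \<xi>) *\<^sub>R \<xi> \<in> perp \<xi>"
      using assms(1) by (simp add: perp_def inner_diff_left norm_eq_1)
    then show ?thesis using B by (simp add: orthonormal_basis_of_def)
  qed
  then show "span (insert \<xi> B) = UNIV" by (auto simp: span_insert)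
qed

lemma subspace_perp: "subspace (perp \<xi>)"
  by (auto simp: perp_def subspace_def inner_add_left)

text \<open>Adjoining \<xi> turns either basis of the hyperplane into an orthonormal basis of the
  whole space, whose measure is \<open>lborel\<close>. By \<open>emeasure_onb_lborel_insert\<close>
  both measures of \<open>A\<close> are then the Lebesgue measure of the same slab.\<close>

lemma subspace_lborel_perp:
  assumes "norm \<xi> = 1" and B: "orthonormal_basis_of (perp \<xi>) B"
  shows "subspace_lborel (perp \<xi>) = onb_lborel B"
proof -
  define B' where "B' = (SOME B. orthonormal_basis_of (perp \<xi>) B)"
  have B': "orthonormal_basis_of (perp \<xi>) B'"
    unfolding B'_def using someI_ex[OF orthonormal_basis_of_exists[OF subspace_perp]] .
  have "onb_lborel B' = onb_lborel B"
  proof (rule measure_eqI)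
    fix A assume "A \<in> sets (onb_lborel B')"
    then have A: "A \<in> sets borel" by simp
    show "emeasure (onb_lborel B') A = emeasure (onb_lborel B) A"
      using emeasure_onb_lborel_insert[OF orthonormal_basis_of_perp(1-3)[OF assms(1) B'] A]
        emeasure_onb_lborel_insert[OF orthonormal_basis_of_perp(1-3)[OF assms] A]
        onb_lborel_eq_lborel[OF orthonormal_basis_of_perp(1,2,4)[OF assms(1) B']]
        onb_lborel_eq_lborel[OF orthonormal_basis_of_perp(1,2,4)[OF assms]]
      by simp
  qed simp
  then show ?thesis by (simp add: subspace_lborel_def onb_lborel_def B'_def Let_def)
qed

section \<open>The profile function\<close>

text \<open>The power x_+^(m/2), written with a square root so that odd \<open>m\<close> needs no
  real exponent. Up to \<open>unit_ball_vol m\<close> it is the volume of an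
  \<open>m\<close>-dimensional ball of squared radius \<open>x\<close>, and a negative
  \<open>x\<close> stands for an empty slice. For \<open>m = 0\<close> it is 1 even at negative
  \<open>x\<close>, hence the hypotheses \<open>0 < m\<close> below.\<close>

definition hpow :: "nat \<Rightarrow> real \<Rightarrow> real" where
  "hpow m x = sqrt (max 0 x) ^ m"

lemma hpow_nonneg: "0 \<le> hpow m x"
  by (simp add: hpow_def)

lemma hpow_mono: "x \<le> y \<Longrightarrow> hpow m x \<le> hpow m y"
  unfolding hpow_def by (intro power_mono) auto

lemma hpow_strict_mono: "x < y \<Longrightarrow> 0 < y \<Longrightarrow> 0 < m \<Longrightarrow> hpow m x < hpow m y"
  unfolding hpow_def by (intro power_strict_mono) auto

lemma hpow_nonpos: "x \<le> 0 \<Longrightarrow> 0 < m \<Longrightarrow> hpow m x = 0"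
  by (simp add: hpow_def)

lemma hpow_power2: "0 \<le> x \<Longrightarrow> hpow m (x\<^sup>2) = x ^ m"
  by (simp add: hpow_def)

lemma hpow_one [simp]: "hpow m 1 = 1"
  by (simp add: hpow_def)

lemma continuous_on_hpow [continuous_intros]:
  "continuous_on S f \<Longrightarrow> continuous_on S (\<lambda>x. hpow m (f x))"
  unfolding hpow_def by (intro continuous_intros)

text \<open>The tangent inequality for s^((k+2)/2) at s = y^2, evaluated at s = x^2 and cleared of
  fractions. Induction on \<open>k\<close> keeps it within natural powers.\<close>

lemma young_power:
  fixes x y :: real
  assumes "0 \<le> x" "0 \<le> y"
  shows "real (k + 2) * x\<^sup>2 * y ^ k \<le> 2 * x ^ (k + 2) + real k * y ^ (k + 2)"
proof (induction k)
  case 0 show ?case by (simp add: power2_eq_square)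
next
  case (Suc k)
  \<comment> \<open>The product is the gap in the inequality for \<open>Suc k\<close> minus
    \<open>y\<close> times the gap for \<open>k\<close>. Its second factor has the sign of
    \<open>x - y\<close>.\<close>
  have "0 \<le> (x - y) * (2 * x ^ (k + 2) - y ^ (k + 1) * x - y ^ (k + 2))"
  proof (cases "y \<le> x")
    case True
    have "y ^ (k + 1) \<le> x ^ (k + 1)" "y ^ (k + 2) \<le> x ^ (k + 2)"
      using True assms by (auto intro: power_mono simp del: power_Suc)
    moreover from this have "y ^ (k + 1) * x \<le> x ^ (k + 1) * x"
      using assms by (intro mult_right_mono)
    ultimately show ?thesis using True by (intro mult_nonneg_nonneg) (auto simp: algebra_simps)
  next
    case False
    then have "x ^ (k + 1) \<le> y ^ (k + 1)" "x ^ (k + 2) \<le> y ^ (k + 2)"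
      using assms by (auto intro: power_mono simp del: power_Suc)
    moreover from this have "x ^ (k + 1) * x \<le> y ^ (k + 1) * x"
      using assms by (intro mult_right_mono)
    ultimately show ?thesis using False by (intro mult_nonpos_nonpos) (auto simp: algebra_simps)
  qed
  then show ?case
    using mult_right_mono[OF Suc.IH assms(2)] by (simp add: algebra_simps power2_eq_square)
qed

text \<open>A convex function lies above its tangents. This replaces differentiating the section
  moment in \<epsilon>: it gives a lower bound valid for every \<epsilon> and sharp to first
  order.\<close>

lemma hpow_tangent:
  assumes "0 < k"
  shows "real (k + 2) / 2 * hpow k y * (x - y) \<le> hpow (k + 2) x - hpow (k + 2) y"
proof (cases "y \<le> 0")
  case True
  then show ?thesis using assms hpow_nonneg by (simp add: hpow_nonpos)
next
  case False
  have "real (k + 2) / 2 * hpow k y * (x - y) \<le> real (k + 2) / 2 * hpow k y * (max 0 x - y)"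
    by (intro mult_left_mono mult_nonneg_nonneg hpow_nonneg) auto
  also have "\<dots> \<le> hpow (k + 2) x - hpow (k + 2) y"
  proof -
    define a b where "a = sqrt (max 0 x)" and "b = sqrt y"
    have "max 0 x = a\<^sup>2" "y = b\<^sup>2" "hpow k y = b ^ k" "hpow (k + 2) x = a ^ (k + 2)"
      "hpow (k + 2) y = b ^ (k + 2)" "0 \<le> a" "0 \<le> b"
      using False by (auto simp: a_def b_def hpow_def max_absorb2)
    then show ?thesis
      using young_power[of a b k] by (simp add: field_simps power2_eq_square)
  qed
  finally show ?thesis .
qed

text \<open>Convexity again, but with the tangent at \<open>x\<close>, the first point of the
  difference, so that the difference is bounded from above.\<close>

lemma power_tangent:
  fixes x y :: real
  assumes "0 \<le> x" "0 \<le> y"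
  shows "x ^ Suc n - y ^ Suc n \<le> real (Suc n) * x ^ n * (x - y)"
proof (induction n)
  case (Suc n)
  \<comment> \<open>This is the gap for \<open>Suc n\<close> minus \<open>x\<close> times the gap
    for \<open>n\<close>.\<close>
  have "0 \<le> (x ^ Suc n - y ^ Suc n) * (x - y)"
    using assms by (cases "y \<le> x")
      (auto intro!: mult_nonneg_nonneg mult_nonpos_nonpos power_mono simp del: power_Suc)
  then show ?case
    using mult_left_mono[OF Suc.IH assms(1)] by (simp add: algebra_simps)
qed simp

section \<open>Positivity of integrals and of perturbed functions\<close>

lemma integral_pos:
  fixes f :: "real \<Rightarrow> real"
  assumes "continuous_on {a..b} f" "a < b" "\<And>x. x \<in> {a..b} \<Longrightarrow> 0 \<le> f x" "c \<in> {a..b}" "0 < f c"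
  shows "0 < integral {a..b} f"
proof -
  have "0 \<le> integral {a..b} f"
    using assms by (intro integral_nonneg integrable_continuous_interval) auto
  moreover have "integral {a..b} f \<noteq> 0"
    using integral_eq_0_iff[of a b f] assms by force
  ultimately show ?thesis by simp
qed

text \<open>A moment carries the odd weight \<open>t\<close>. Pairing \<open>t\<close> with
  \<open>- t\<close> over the cylinder part leaves differences of values of the profile, which are
  of first order in \<epsilon>; \<open>{1..b}\<close> is the added cap.\<close>

lemma integral_symmetric_split:
  fixes f :: "real \<Rightarrow> real"
  assumes "continuous_on UNIV f" "1 \<le> b"
  shows "integral {-1..b} f = integral {0..1} (\<lambda>t. f t + f (- t)) + integral {1..b} f"
proof -
  have int: "f integrable_on {x..y}" for x y
    using assms(1) by (intro integrable_continuous_interval) (auto intro: continuous_on_subset)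
  have "integral {-1..b} f = integral {-1..0} f + integral {0..1} f + integral {1..b} f"
    using Henstock_Kurzweil_Integration.integral_combine[of "-1" 0 b f]
      Henstock_Kurzweil_Integration.integral_combine[of 0 1 b f] int assms(2) by simp
  also have "integral {-1..0} f = integral {0..1} (\<lambda>t. f (- t))"
    using Henstock_Kurzweil_Integration.integral_reflect_real[where a = "-1" and b = 0 and f = f] by simp
  also have "integral {0..1} (\<lambda>t. f (- t)) + integral {0..1} f = integral {0..1} (\<lambda>t. f t + f (- t))"
    using int by (subst integral_add)
     (auto intro!: integrable_continuous_interval continuous_on_compose2[OF assms(1)] continuous_intros)
  finally show ?thesis .
qed

text \<open>Near 0, where \<open>f\<close> may vanish, \<open>g\<close> is positive by continuity.
  Away from 0, \<open>f\<close> has a positive minimum by compactness, which absorbs a small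
  multiple of \<open>g\<close>.\<close>

lemma positive_perturbation:
  fixes f g :: "real \<Rightarrow> real"
  assumes f: "continuous_on {0..c} f" and g: "continuous_on {0..c} g" and "0 < c"
    and f0: "f 0 = 0" and fpos: "\<And>u. 0 < u \<Longrightarrow> u \<le> c \<Longrightarrow> 0 < f u" and "0 < g 0"
  obtains \<delta> where "0 < \<delta>" "\<And>\<eta> u. 0 < \<eta> \<Longrightarrow> \<eta> \<le> \<delta> \<Longrightarrow> u \<in> {0..c} \<Longrightarrow> 0 < f u + \<eta> * g u"
proof -
  obtain d where d: "d > 0" "\<And>u. u \<in> {0..c} \<Longrightarrow> \<bar>u\<bar> < d \<Longrightarrow> 0 < g u"
  proof -
    have "\<exists>d>0. \<forall>u\<in>{0..c}. dist u 0 < d \<longrightarrow> dist (g u) (g 0) < g 0"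
      using g[unfolded continuous_on_iff, rule_format, of 0 "g 0"] \<open>0 < g 0\<close> \<open>0 < c\<close> by auto
    then show ?thesis using that by (force simp: dist_real_def)
  qed
  let ?d = "min d c"
  have "{?d..c} \<subseteq> {0..c}" using \<open>0 < c\<close> d(1) by auto
  then have "compact {?d..c}" "{?d..c} \<noteq> {}" "continuous_on {?d..c} f"
    using continuous_on_subset[OF f] by auto
  then obtain v where v: "v \<in> {?d..c}" "\<And>u. u \<in> {?d..c} \<Longrightarrow> f v \<le> f u"
    using continuous_attains_inf by metis
  have fv: "0 < f v" using v(1) d(1) \<open>0 < c\<close> by (intro fpos) auto
  obtain B where B: "B > 0" "\<And>u. u \<in> {0..c} \<Longrightarrow> \<bar>g u\<bar> \<le> B"
    using compact_imp_bounded[OF compact_continuous_image[OF g compact_Icc]]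
    unfolding bounded_pos by auto
  show ?thesis
  \<comment> \<open>With \<open>B\<close> bounding \<open>\<bar>g u\<bar>\<close>, the perturbation
    is at most half of the minimum \<open>f v\<close> of \<open>f\<close> away from 0.\<close>
  proof (rule that[of "f v / (2 * B)"])
    show "0 < f v / (2 * B)" using fv B by simp
    fix \<eta> u assume \<eta>: "0 < \<eta>" "\<eta> \<le> f v / (2 * B)" and u: "u \<in> {0..c}"
    show "0 < f u + \<eta> * g u"
    proof (cases "u < d")
      case True
      then have "0 < g u" using d(2) u by auto
      moreover have "0 \<le> f u" using fpos[of u] f0 u by (cases "u = 0") auto
      ultimately show ?thesis using \<eta> by (intro add_nonneg_pos mult_pos_pos) auto
    next
      case False
      then have "f v \<le> f u" using v(2)[of u] u by auto
      moreover have "\<bar>\<eta> * g u\<bar> \<le> f v / (2 * B) * B"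
        unfolding abs_mult using \<eta> B(2)[OF u] B(1) fv by (intro mult_mono) auto
      ultimately show ?thesis using fv B(1) by (auto simp: field_simps)
    qed
  qed
qed

text \<open>A tube lemma: the minimum over the slice \<epsilon> = 0 is positive, and uniform
  continuity on the compact rectangle keeps the change below that minimum once \<epsilon> is small,
  uniformly in \<open>u\<close>.\<close>

lemma positive_tube:
  fixes \<Phi> :: "real \<times> real \<Rightarrow> real"
  assumes \<Phi>: "continuous_on ({0..1} \<times> {0..c}) \<Phi>" and "0 \<le> c"
    and pos: "\<And>u. u \<in> {0..c} \<Longrightarrow> 0 < \<Phi> (0, u)"
  obtains \<delta> where "0 < \<delta>" "\<And>\<epsilon> u. 0 \<le> \<epsilon> \<Longrightarrow> \<epsilon> \<le> 1 \<Longrightarrow> \<epsilon> < \<delta> \<Longrightarrow> u \<in> {0..c} \<Longrightarrow> 0 < \<Phi> (\<epsilon>, u)"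
proof -
  have "continuous_on {0..c} (\<lambda>u. \<Phi> (0, u))"
    by (rule continuous_on_compose2[OF \<Phi>]) (auto intro!: continuous_intros)
  then obtain v where v: "v \<in> {0..c}" "\<And>u. u \<in> {0..c} \<Longrightarrow> \<Phi> (0, v) \<le> \<Phi> (0, u)"
    using continuous_attains_inf[of "{0..c}" "\<lambda>u. \<Phi> (0, u)"] \<open>0 \<le> c\<close> by auto
  have "uniformly_continuous_on ({0..1} \<times> {0..c}) \<Phi>"
    by (intro compact_uniformly_continuous \<Phi> compact_Times compact_Icc)
  then obtain \<delta> where \<delta>: "\<delta> > 0" "\<And>x y. x \<in> {0..1} \<times> {0..c} \<Longrightarrow> y \<in> {0..1} \<times> {0..c} \<Longrightarrow>
      dist y x < \<delta> \<Longrightarrow> dist (\<Phi> y) (\<Phi> x) < \<Phi> (0, v)"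
    unfolding uniformly_continuous_on_def using pos[OF v(1)] by meson
  show ?thesis
  proof (rule that[OF \<delta>(1)])
    fix \<epsilon> u :: real assume *: "0 \<le> \<epsilon>" "\<epsilon> \<le> 1" "\<epsilon> < \<delta>" "u \<in> {0..c}"
    have "dist (\<Phi> (\<epsilon>, u)) (\<Phi> (0, u)) < \<Phi> (0, v)"
      using * by (intro \<delta>(2)) (auto simp: dist_Pair_Pair)
    then show "0 < \<Phi> (\<epsilon>, u)" using v(2)[OF *(4)] by (auto simp: dist_real_def)
  qed
qed

section \<open>The first-order functional\<close>

lemma integral_poly_2_4: "integral {0..1} (\<lambda>t::real. p * t\<^sup>2 - q * t ^ 4) = p / 3 - q / 5"
proof -
  have "((\<lambda>t::real. p * t\<^sup>2 - q * t ^ 4) has_integral (p * 1 ^ 3 / 3 - q * 1 ^ 5 / 5) - (p * 0 ^ 3 / 3 - q * 0 ^ 5 / 5)) {0..1}"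
    by (intro fundamental_theorem_of_calculus)
       (auto intro!: derivative_eq_intros simp: field_simps simp flip: has_real_derivative_iff_has_vector_derivative)
  then show ?thesis by (simp add: integral_unique)
qed

text \<open>The polynomial has integral 0 and changes sign once, at t^2 = 3/5. Subtracting from the
  decreasing weight its value \<open>?v\<close> at the crossing leaves the integral unchanged and
  makes both factors agree in sign everywhere.\<close>

lemma single_crossing_pos:
  assumes "0 < k" "0 < u"
  shows "0 < integral {0..1} (\<lambda>t. (2 * t\<^sup>2 - 10 / 3 * t ^ 4) * hpow k (1 - u * t\<^sup>2))"
proof -
  let ?p = "\<lambda>t::real. 2 * t\<^sup>2 - 10 / 3 * t ^ 4" and ?w = "\<lambda>t. hpow k (1 - u * t\<^sup>2)"
  let ?v = "hpow k (1 - u * (3 / 5))"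
  have p: "?p t = 10 / 3 * t\<^sup>2 * (3 / 5 - t\<^sup>2)" for t :: real
    by (simp add: algebra_simps power4_eq_xxxx power2_eq_square)
  \<comment> \<open>A point before the crossing at which the weight is positive:
    \<open>?c\<^sup>2 < 3 / 5\<close> and \<open>u * ?c\<^sup>2 < 1\<close>. There the weight
    strictly exceeds \<open>?v\<close>, so the integrand is strictly positive.\<close>
  let ?c = "1 / (2 * sqrt (1 + u))"
  have c2: "?c\<^sup>2 = 1 / (4 * (1 + u))" using assms by (simp add: power_divide power_mult_distrib)
  have "1 * 1 \<le> 2 * sqrt (1 + u)" using assms by (intro mult_mono) auto
  then have c: "?c \<in> {0..1}" using assms by (auto simp: field_simps)
  have "0 < integral {0..1} (\<lambda>t. ?p t * (?w t - ?v))"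
  proof (rule integral_pos[OF _ _ _ c])
    show "continuous_on {0..1} (\<lambda>t. ?p t * (?w t - ?v))" by (intro continuous_intros)
    show "0 \<le> ?p t * (?w t - ?v)" for t :: real
    proof (cases "t\<^sup>2 \<le> 3 / 5")
      case True
      then have "?v \<le> ?w t" using assms by (intro hpow_mono) auto
      then show ?thesis unfolding p using True by (intro mult_nonneg_nonneg) auto
    next
      case False
      then have "?w t \<le> ?v" using assms by (intro hpow_mono) auto
      moreover have "?p t \<le> 0" unfolding p using False by (intro mult_nonneg_nonpos) auto
      ultimately show ?thesis by (intro mult_nonpos_nonpos) auto
    qed
    have "?c\<^sup>2 < 3 / 5" "u * ?c\<^sup>2 < 1" "0 < ?c\<^sup>2"
      using assms unfolding c2 by (auto simp: field_simps)
    then have "?v < ?w ?c" using assms by (intro hpow_strict_mono) auto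
    then show "0 < ?p ?c * (?w ?c - ?v)"
      unfolding p using \<open>?c\<^sup>2 < 3 / 5\<close> \<open>0 < ?c\<^sup>2\<close> by (intro mult_pos_pos) auto
  qed simp
  also have "(\<lambda>t. ?p t * (?w t - ?v)) = (\<lambda>t. ?p t * ?w t - ?p t * ?v)"
    by (simp add: algebra_simps)
  also have "integral {0..1} \<dots> = integral {0..1} (\<lambda>t. ?p t * ?w t) - integral {0..1} ?p * ?v"
    by (subst integral_diff)
      (auto intro!: integrable_continuous_interval continuous_intros)
  also have "integral {0..1} ?p = 0" using integral_poly_2_4[of 2 "10 / 3"] by simp
  finally show ?thesis by simp
qed

text \<open>\<open>?f\<close> is the functional at \<kappa> = 10/3 without a cap; it vanishes only
  at \<open>u = 0\<close>. \<open>?g\<close> is the effect, per unit of \<eta>, of raising \<kappa>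
  and adding a cap. The cap coefficient (k + 2 + 1/2) / 5 exceeds the (k + 2) / 5 needed for
  \<open>0 < ?g 0\<close>, yet stays below the (k + 3) / 5 that would balance the centroid. The
  range ends at 16 because larger \<open>u\<close> are handled directly by
  \<open>section_moment_pos_large\<close>.\<close>

lemma first_order_functional_pos:
  assumes "0 < k"
  obtains \<eta> :: real where "0 < \<eta>" "\<eta> \<le> 2 / 3"
    "\<And>u. u \<in> {0..16} \<Longrightarrow>
      0 < real (k + 2) * integral {0..1} (\<lambda>t. t * (2 * t - (10 / 3 + \<eta>) * t ^ 3) * hpow k (1 - u * t\<^sup>2))
        + (real (k + 2) + 1 / 2) * \<eta> / 5 * hpow (k + 2) (1 - u)"
proof -
  let ?w = "\<lambda>u t. hpow k (1 - u * t\<^sup>2)"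
  let ?f = "\<lambda>u. real (k + 2) * integral {0..1} (\<lambda>t. (2 * t\<^sup>2 - 10 / 3 * t ^ 4) * ?w u t)"
  let ?g = "\<lambda>u. (real (k + 2) + 1 / 2) / 5 * hpow (k + 2) (1 - u) - real (k + 2) * integral {0..1} (\<lambda>t. t ^ 4 * ?w u t)"
  have "continuous_on {0..16} ?f"
    by (intro continuous_intros integral_continuous_on_param[where a = "0::real" and b = 1, simplified])
      (auto simp: case_prod_beta intro!: continuous_intros)
  moreover have "continuous_on {0..16} ?g"
    by (intro continuous_intros integral_continuous_on_param[where a = "0::real" and b = 1, simplified])
      (auto simp: case_prod_beta intro!: continuous_intros)
  moreover have "?f 0 = 0" using integral_poly_2_4[of 2 "10 / 3"] by simp
  moreover have "0 < ?f u" if "0 < u" for u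
    using single_crossing_pos[OF assms that] by simp
  moreover have "0 < ?g 0"
  proof -
    have "integral {0..1} (\<lambda>t::real. t ^ 4) = 1 / 5"
      using integral_poly_2_4[of 0 "-1"] by simp
    then have "?g 0 = (real (k + 2) + 1 / 2) / 5 - real (k + 2) * (1 / 5)"
      by (simp only: mult_zero_left diff_zero hpow_one mult_1_right)
    then show ?thesis by (simp add: field_simps)
  qed
  ultimately obtain \<delta> where \<delta>: "0 < \<delta>"
    "\<And>\<eta> u. 0 < \<eta> \<Longrightarrow> \<eta> \<le> \<delta> \<Longrightarrow> u \<in> {0..16} \<Longrightarrow> 0 < ?f u + \<eta> * ?g u"
    using positive_perturbation[of 16 ?f ?g] by auto
  show ?thesis
  \<comment> \<open>The cap 2/3 keeps \<kappa> = 10/3 + \<eta> at most 4, as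
    \<open>section_moment_pos_large\<close> requires.\<close>
  proof (rule that[of "min \<delta> (2 / 3)"])
    let ?\<eta> = "min \<delta> (2 / 3)"
    fix u :: real assume u: "u \<in> {0..16}"
    have "0 < ?f u + ?\<eta> * ?g u" using \<delta> u by auto
    also have "(\<lambda>t. t * (2 * t - (10 / 3 + ?\<eta>) * t ^ 3) * ?w u t) =
       (\<lambda>t. (2 * t\<^sup>2 - 10 / 3 * t ^ 4) * ?w u t - ?\<eta> * (t ^ 4 * ?w u t))"
      by (simp add: fun_eq_iff algebra_simps power4_eq_xxxx power3_eq_cube power2_eq_square)
    then have "integral {0..1} (\<lambda>t. t * (2 * t - (10 / 3 + ?\<eta>) * t ^ 3) * ?w u t) =
      integral {0..1} (\<lambda>t. (2 * t\<^sup>2 - 10 / 3 * t ^ 4) * ?w u t) - ?\<eta> * integral {0..1} (\<lambda>t. t ^ 4 * ?w u t)"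
      by (simp only:) (subst integral_diff, auto intro!: integrable_continuous_interval continuous_intros)
    then have "?f u + ?\<eta> * ?g u = real (k + 2) * integral {0..1} (\<lambda>t. t * (2 * t - (10 / 3 + ?\<eta>) * t ^ 3) * ?w u t)
        + (real (k + 2) + 1 / 2) * ?\<eta> / 5 * hpow (k + 2) (1 - u)"
      by (simp only:) (simp add: algebra_simps)
    finally show "0 < real (k + 2) * integral {0..1} (\<lambda>t. t * (2 * t - (10 / 3 + ?\<eta>) * t ^ 3) * ?w u t)
        + (real (k + 2) + 1 / 2) * ?\<eta> / 5 * hpow (k + 2) (1 - u)" .
  qed (use \<delta> in auto)
qed

section \<open>The perturbed profile and its moments\<close>

definition profile :: "real \<Rightarrow> real \<Rightarrow> real \<Rightarrow> real" where
  "profile \<kappa> \<epsilon> t = 1 + \<epsilon> * (t - \<kappa> * max 0 t ^ 3)"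

text \<open>The function \<open>max 0 t ^ 3\<close> is convex, because the cube is increasing and
  convex on nonnegative numbers and \<open>max 0 t\<close> is convex. Cutting the cube off at 0
  matters: -t^3 is convex, not concave, for negative \<open>t\<close>.\<close>

lemma concave_on_profile:
  assumes "0 \<le> \<kappa>" "0 \<le> \<epsilon>"
  shows "concave_on UNIV (profile \<kappa> \<epsilon>)"
proof -
  have "convex_on UNIV (\<lambda>t::real. max 0 t ^ 3)"
  proof (rule convex_onI)
    fix s x y :: real assume s: "0 < s" "s < 1"
    have "max 0 ((1 - s) * x + s * y) \<le> (1 - s) * max 0 x + s * max 0 y"
      using s by (auto intro!: add_mono mult_left_mono)
    then have "max 0 ((1 - s) * x + s * y) ^ 3 \<le> ((1 - s) * max 0 x + s * max 0 y) ^ 3"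
      by (intro power_mono) auto
    also have "\<dots> \<le> (1 - s) * max 0 x ^ 3 + s * max 0 y ^ 3"
      using convex_onD[OF convex_power_odd[of 3], of s "max 0 x" "max 0 y"] s by simp
    finally show "max 0 ((1 - s) *\<^sub>R x + s *\<^sub>R y) ^ 3 \<le> (1 - s) * max 0 x ^ 3 + s * max 0 y ^ 3"
      by simp
  qed simp
  then have conv: "max 0 ((1 - s) * x + s * y) ^ 3 \<le> (1 - s) * max 0 x ^ 3 + s * max 0 y ^ 3"
    if "0 \<le> s" "s \<le> 1" for s x y :: real
    using convex_onD[of UNIV "\<lambda>t::real. max 0 t ^ 3" s x y] that by simp
  have "(1 - s) * profile \<kappa> \<epsilon> x + s * profile \<kappa> \<epsilon> y \<le> profile \<kappa> \<epsilon> ((1 - s) * x + s * y)"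
    if "0 < s" "s < 1" for s x y
  proof -
    have "\<epsilon> * \<kappa> * max 0 ((1 - s) * x + s * y) ^ 3 \<le> \<epsilon> * \<kappa> * ((1 - s) * max 0 x ^ 3 + s * max 0 y ^ 3)"
      using assms that by (intro mult_left_mono conv) auto
    then show ?thesis by (simp add: profile_def algebra_simps)
  qed
  then show ?thesis
    unfolding concave_on_def by (intro convex_onI) (auto simp: algebra_simps)
qed

lemma continuous_on_profile [continuous_intros]:
  "continuous_on S f \<Longrightarrow> continuous_on S (\<lambda>x. profile \<kappa> \<epsilon> (f x))"
  unfolding profile_def by (intro continuous_intros)

text \<open>The function F of the overview. With \<open>u = 0\<close> and \<open>m\<close> one less
  than the dimension of the space it also gives the axial moment of the whole body.\<close>

definition section_moment :: "nat \<Rightarrow> (real \<Rightarrow> real) \<Rightarrow> real \<Rightarrow> real \<Rightarrow> real \<Rightarrow> real" where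
  "section_moment m r a b u = integral {a..b} (\<lambda>t. t * hpow m ((r t)\<^sup>2 - u * t\<^sup>2))"

text \<open>A crude bound: \<kappa> t_+^3 is at most 8 \<kappa> for \<open>t\<close> up to 2, and
  the right end of the body stays below 2 as long as \<epsilon> \<beta> is at most 1.\<close>

lemma profile_bounds:
  assumes "0 \<le> \<epsilon>" "10 / 3 \<le> \<kappa>" "8 * \<kappa> * \<epsilon> \<le> 1 / 2" "t \<in> {-1..2}"
  shows "1 - 8 * \<kappa> * \<epsilon> \<le> profile \<kappa> \<epsilon> t" "0 < profile \<kappa> \<epsilon> t"
proof -
  define q where "q = \<kappa> * max 0 t ^ 3"
  have "q \<le> \<kappa> * (if t \<le> 0 then 0 else 8)"
    unfolding q_def using assms power_mono[of t 2 3] by (intro mult_left_mono) auto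
  then have "- (8 * \<kappa>) \<le> t - q" using assms by (cases "t \<le> 0") auto
  then have "- (8 * \<kappa>) \<le> t - \<kappa> * max 0 t ^ 3" by (simp add: q_def)
  then have "\<epsilon> * - (8 * \<kappa>) \<le> \<epsilon> * (t - \<kappa> * max 0 t ^ 3)" using assms by (intro mult_left_mono) auto
  then show "1 - 8 * \<kappa> * \<epsilon> \<le> profile \<kappa> \<epsilon> t" by (simp add: profile_def algebra_simps)
  then show "0 < profile \<kappa> \<epsilon> t" using assms by linarith
qed

lemma profile_diff:
  assumes "0 \<le> t"
  shows "profile \<kappa> \<epsilon> t - profile \<kappa> \<epsilon> (- t) = \<epsilon> * (2 * t - \<kappa> * t ^ 3)"
    "profile \<kappa> \<epsilon> t + profile \<kappa> \<epsilon> (- t) = 2 - \<epsilon> * \<kappa> * t ^ 3"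
    "profile \<kappa> \<epsilon> (- t) = 1 - \<epsilon> * t"
  using assms by (simp_all add: profile_def max_absorb2 max_absorb1 algebra_simps)

text \<open>On the cap the weight \<open>t\<close> is at least 1, the radius is at least 1 - 8
  \<kappa> \<epsilon>, and u t^2 is largest at the right end. After division by \<epsilon> this
  constant bound still tends to the correct cap term \<beta> (1 - u)_+^(m/2).\<close>

lemma cap_moment_lower:
  assumes "0 \<le> \<epsilon>" "10 / 3 \<le> \<kappa>" "8 * \<kappa> * \<epsilon> \<le> 1 / 2" "0 \<le> \<epsilon> * \<beta>" "\<epsilon> * \<beta> \<le> 1" "0 \<le> u"
  shows "\<epsilon> * \<beta> * hpow m ((1 - 8 * \<kappa> * \<epsilon>)\<^sup>2 - u * (1 + \<epsilon> * \<beta>)\<^sup>2)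
    \<le> section_moment m (profile \<kappa> \<epsilon>) 1 (1 + \<epsilon> * \<beta>) u"
proof -
  let ?b = "1 + \<epsilon> * \<beta>"
  let ?c = "hpow m ((1 - 8 * \<kappa> * \<epsilon>)\<^sup>2 - u * ?b\<^sup>2)"
  have "\<epsilon> * \<beta> * ?c = integral {1..?b} (\<lambda>t. ?c)" using assms by simp
  also have "\<dots> \<le> section_moment m (profile \<kappa> \<epsilon>) 1 ?b u"
    unfolding section_moment_def
  proof (intro integral_le integrable_continuous_interval continuous_intros)
    fix t assume t: "t \<in> {1..?b}"
    have "(1 - 8 * \<kappa> * \<epsilon>)\<^sup>2 \<le> (profile \<kappa> \<epsilon> t)\<^sup>2" using profile_bounds[of \<epsilon> \<kappa> t] assms t by (intro power_mono) auto
    moreover have "u * t\<^sup>2 \<le> u * ?b\<^sup>2" using assms t by (intro mult_left_mono power_mono) auto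
    ultimately have "1 * ?c \<le> t * hpow m ((profile \<kappa> \<epsilon> t)\<^sup>2 - u * t\<^sup>2)"
      using t by (intro mult_mono hpow_mono hpow_nonneg) auto
    then show "?c \<le> t * hpow m ((profile \<kappa> \<epsilon> t)\<^sup>2 - u * t\<^sup>2)" by simp
  qed
  finally show ?thesis .
qed

lemma section_moment_split:
  assumes "1 \<le> b"
  shows "section_moment m (profile \<kappa> \<epsilon>) (-1) b u =
    integral {0..1} (\<lambda>t. t * (hpow m ((profile \<kappa> \<epsilon> t)\<^sup>2 - u * t\<^sup>2) - hpow m ((profile \<kappa> \<epsilon> (- t))\<^sup>2 - u * t\<^sup>2)))
    + section_moment m (profile \<kappa> \<epsilon>) 1 b u"
  unfolding section_moment_def
  by (subst integral_symmetric_split[OF _ assms])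
    (auto intro!: continuous_intros simp: algebra_simps)

text \<open>The tangent inequality on the folded cylinder plus the constant bound on the cap. The
  factor after \<epsilon> is continuous at \<epsilon> = 0, where it equals the first-order
  functional, so positivity there passes to small \<epsilon>.\<close>

lemma section_moment_lower:
  assumes "0 \<le> \<epsilon>" "10 / 3 \<le> \<kappa>" "8 * \<kappa> * \<epsilon> \<le> 1 / 2" "0 \<le> \<epsilon> * \<beta>" "\<epsilon> * \<beta> \<le> 1" "0 \<le> u" "0 < k"
  shows "\<epsilon> * (real (k + 2) / 2 * integral {0..1}
        (\<lambda>t. t * (2 * t - \<kappa> * t ^ 3) * (2 - \<epsilon> * \<kappa> * t ^ 3) * hpow k ((1 - \<epsilon> * t)\<^sup>2 - u * t\<^sup>2))
      + \<beta> * hpow (k + 2) ((1 - 8 * \<kappa> * \<epsilon>)\<^sup>2 - u * (1 + \<epsilon> * \<beta>)\<^sup>2))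
    \<le> section_moment (k + 2) (profile \<kappa> \<epsilon>) (-1) (1 + \<epsilon> * \<beta>) u"
proof -
  let ?r = "profile \<kappa> \<epsilon>"
  let ?h = "\<lambda>t. t * (2 * t - \<kappa> * t ^ 3) * (2 - \<epsilon> * \<kappa> * t ^ 3) * hpow k ((1 - \<epsilon> * t)\<^sup>2 - u * t\<^sup>2)"
  let ?d = "\<lambda>t. t * (hpow (k + 2) ((?r t)\<^sup>2 - u * t\<^sup>2) - hpow (k + 2) ((?r (- t))\<^sup>2 - u * t\<^sup>2))"
  have "\<epsilon> * (real (k + 2) / 2) * integral {0..1} ?h = integral {0..1} (\<lambda>t. \<epsilon> * (real (k + 2) / 2) * ?h t)"
    by simp
  also have "\<dots> \<le> integral {0..1} ?d"
  proof (intro integral_le integrable_continuous_interval continuous_intros)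
    fix t :: real assume t: "t \<in> {0..1}"
    \<comment> \<open>The tangent is taken at the point - t, where the profile is simply 1 -
      \<epsilon> t; the increment factors as a difference of squares.\<close>
    have "(?r t)\<^sup>2 - (?r (- t))\<^sup>2 = (?r t - ?r (- t)) * (?r t + ?r (- t))"
      by (simp add: power2_eq_square algebra_simps)
    also have "\<dots> = \<epsilon> * (2 * t - \<kappa> * t ^ 3) * (2 - \<epsilon> * \<kappa> * t ^ 3)"
      using profile_diff[of t \<kappa> \<epsilon>] t by simp
    finally have "\<epsilon> * (real (k + 2) / 2) * ?h t =
        t * (real (k + 2) / 2 * hpow k ((?r (- t))\<^sup>2 - u * t\<^sup>2) * (((?r t)\<^sup>2 - u * t\<^sup>2) - ((?r (- t))\<^sup>2 - u * t\<^sup>2)))"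
      using profile_diff(3)[of t \<kappa> \<epsilon>] t by simp
    also have "\<dots> \<le> ?d t"
      using t by (intro mult_left_mono hpow_tangent assms) auto
    finally show "\<epsilon> * (real (k + 2) / 2) * ?h t \<le> ?d t" .
  qed
  finally have "\<epsilon> * (real (k + 2) / 2) * integral {0..1} ?h \<le> integral {0..1} ?d" .
  then have "\<epsilon> * (real (k + 2) / 2) * integral {0..1} ?h + \<epsilon> * \<beta> * hpow (k + 2) ((1 - 8 * \<kappa> * \<epsilon>)\<^sup>2 - u * (1 + \<epsilon> * \<beta>)\<^sup>2)
    \<le> section_moment (k + 2) ?r (-1) (1 + \<epsilon> * \<beta>) u"
    using section_moment_split[of "1 + \<epsilon> * \<beta>" "k + 2" \<kappa> \<epsilon> u]
      cap_moment_lower[of \<epsilon> \<kappa> \<beta> u "k + 2"] assms by linarith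
  then show ?thesis by (simp only: distrib_left mult.assoc)
qed

text \<open>For large \<open>u\<close> the section lives close to the origin: where t is at least
  1/3 the positive part vanishes, and for smaller positive t the profile is larger at t than at - t.
  Compactness is therefore needed only for bounded \<open>u\<close>.\<close>

lemma section_moment_pos_large:
  assumes "0 < \<epsilon>" "10 / 3 \<le> \<kappa>" "\<kappa> \<le> 4" "8 * \<kappa> * \<epsilon> \<le> 1 / 2" "0 \<le> \<epsilon> * \<beta>" "\<epsilon> * \<beta> \<le> 1" "16 \<le> u" "0 < m"
  shows "0 < section_moment m (profile \<kappa> \<epsilon>) (-1) (1 + \<epsilon> * \<beta>) u"
proof -
  let ?r = "profile \<kappa> \<epsilon>"
  let ?d = "\<lambda>t. t * (hpow m ((?r t)\<^sup>2 - u * t\<^sup>2) - hpow m ((?r (- t))\<^sup>2 - u * t\<^sup>2))"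
  have "8 * (10 / 3) * \<epsilon> \<le> 8 * \<kappa> * \<epsilon>" using assms by (intro mult_right_mono) auto
  then have eps: "\<epsilon> \<le> 1" using assms by linarith
  have r: "0 < ?r t" "0 < ?r (- t)" if "t \<in> {0..1}" for t
    using profile_bounds(2)[of \<epsilon> \<kappa>] assms that by auto
  have lt: "?r (- t) < ?r t" if "0 < t" "t \<le> 1 / 3" for t
  proof -
    have "t ^ 2 \<le> (1 / 3) ^ 2" using that by (intro power_mono) auto
    then have "\<kappa> * t ^ 2 \<le> 4 * (1 / 3) ^ 2" using assms by (intro mult_mono) auto
    then have "0 < t * (2 - \<kappa> * t ^ 2)" using that by (intro mult_pos_pos) (auto simp: power2_eq_square)
    then have "0 < \<epsilon> * (2 * t - \<kappa> * t ^ 3)"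
      using assms(1) by (intro mult_pos_pos) (auto simp: power2_eq_square power3_eq_cube algebra_simps)
    then show ?thesis using profile_diff(1)[of t \<kappa> \<epsilon>] that by simp
  qed
  have far: "(?r s)\<^sup>2 - u * t\<^sup>2 \<le> 0" if "1 / 3 \<le> t" "t \<le> 1" "s = t \<or> s = - t" for s t
  proof -
    have "s - \<kappa> * max 0 s ^ 3 \<le> t" using that assms by auto
    then have "\<epsilon> * (s - \<kappa> * max 0 s ^ 3) \<le> \<epsilon> * t" using assms by (intro mult_left_mono) auto
    also have "\<dots> \<le> 1 * t" using eps that by (intro mult_right_mono) auto
    finally have "?r s \<le> 4 * t" using that by (simp add: profile_def)
    then have "(?r s)\<^sup>2 \<le> (4 * t)\<^sup>2" using r[of t] that by (intro power_mono) auto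
    also have "\<dots> \<le> u * t\<^sup>2" using assms by (simp add: power_mult_distrib mult_right_mono)
    finally show ?thesis by simp
  qed
  \<comment> \<open>A point with \<open>u * ?c\<^sup>2 = 1 / 16\<close>, below the lower bound 1/4
    for the squared radius, so the slice there is nonempty and the comparison strict.\<close>
  let ?c = "1 / (4 * sqrt u)"
  have u: "sqrt 16 \<le> sqrt u" using assms by (subst real_sqrt_le_iff)
  then have su: "4 \<le> sqrt u" by simp
  have c: "0 < ?c" "?c \<le> 1 / 3" using su assms by (auto simp: field_simps)
  have "0 < integral {0..1} ?d"
  proof (rule integral_pos[of 0 1 ?d ?c])
    show "continuous_on {0..1} ?d" by (intro continuous_intros)
    show "0 \<le> ?d t" if "t \<in> {0..1}" for t
    proof (cases "t \<le> 1 / 3 \<and> 0 < t")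
      case True
      then have "(?r (- t))\<^sup>2 \<le> (?r t)\<^sup>2" using lt[of t] r[of t] that by (intro power_mono) auto
      then show ?thesis using True by (intro mult_nonneg_nonneg) (auto intro: hpow_mono)
    next
      case False
      then show ?thesis using far[of t t] far[of t "- t"] that assms(8)
        by (cases "t = 0") (auto simp: hpow_nonpos)
    qed
    have "?r (- ?c) < ?r ?c" using c lt by blast
    moreover have "0 < ?r (- ?c)" using c r[of ?c] by auto
    ultimately have "(?r (- ?c))\<^sup>2 < (?r ?c)\<^sup>2" by (intro power_strict_mono) auto
    moreover have "u * ?c\<^sup>2 = 1 / 16" using assms by (simp add: power_divide power_mult_distrib)
    moreover have "(1/2)\<^sup>2 \<le> (?r ?c)\<^sup>2"
      using profile_bounds(1)[of \<epsilon> \<kappa> ?c] assms c by (intro power_mono) auto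
    ultimately show "0 < ?d ?c" using c assms(8)
      by (intro mult_pos_pos) (auto intro!: hpow_strict_mono simp: power2_eq_square)
  qed (use c in auto)
  moreover have "0 \<le> section_moment m ?r 1 (1 + \<epsilon> * \<beta>) u"
    unfolding section_moment_def
    by (intro integral_nonneg integrable_continuous_interval continuous_intros) (auto intro!: mult_nonneg_nonneg hpow_nonneg)
  ultimately show ?thesis
    using section_moment_split[of "1 + \<epsilon> * \<beta>" m \<kappa> \<epsilon> u] assms by simp
qed

text \<open>The counterpart of \<open>section_moment_lower\<close>: the tangent at the other end
  gives an upper bound, again sharp to first order in \<epsilon>.\<close>

lemma body_moment_upper:
  assumes "0 \<le> \<epsilon>" "10 / 3 \<le> \<kappa>" "8 * \<kappa> * \<epsilon> \<le> 1 / 2" "0 \<le> \<epsilon> * \<beta>" "\<epsilon> * \<beta> \<le> 1"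
  shows "integral {-1..1 + \<epsilon> * \<beta>} (\<lambda>t. t * profile \<kappa> \<epsilon> t ^ Suc m)
    \<le> \<epsilon> * (real (Suc m) * integral {0..1} (\<lambda>t. t * (2 * t - \<kappa> * t ^ 3) * (1 + \<epsilon> * (t - \<kappa> * t ^ 3)) ^ m)
       + \<beta> * (1 + \<epsilon> * \<beta>))"
proof -
  let ?r = "profile \<kappa> \<epsilon>" and ?b = "1 + \<epsilon> * \<beta>"
  let ?h = "\<lambda>t. t * (2 * t - \<kappa> * t ^ 3) * (1 + \<epsilon> * (t - \<kappa> * t ^ 3)) ^ m"
  have "integral {0..1} (\<lambda>t. t * ?r t ^ Suc m + (- t) * ?r (- t) ^ Suc m)
     \<le> integral {0..1} (\<lambda>t. \<epsilon> * real (Suc m) * ?h t)"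
  proof (intro integral_le integrable_continuous_interval continuous_intros)
    fix t :: real assume t: "t \<in> {0..1}"
    have "t * ?r t ^ Suc m + (- t) * ?r (- t) ^ Suc m = t * (?r t ^ Suc m - ?r (- t) ^ Suc m)"
      by (simp add: algebra_simps)
    also have "\<dots> \<le> t * (real (Suc m) * ?r t ^ m * (?r t - ?r (- t)))"
      using profile_bounds(2)[of \<epsilon> \<kappa> t] profile_bounds(2)[of \<epsilon> \<kappa> "- t"] assms t
      by (intro mult_left_mono power_tangent) auto
    also have "\<dots> = t * (real (Suc m) * (1 + \<epsilon> * (t - \<kappa> * t ^ 3)) ^ m * (\<epsilon> * (2 * t - \<kappa> * t ^ 3)))"
    proof -
      have "?r t = 1 + \<epsilon> * (t - \<kappa> * t ^ 3)" using t by (simp add: profile_def max_absorb2)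
      then show ?thesis using profile_diff(1)[of t \<kappa> \<epsilon>] t by (simp only: atLeastAtMost_iff)
    qed
    also have "\<dots> = \<epsilon> * real (Suc m) * ?h t" by (simp add: mult_ac)
    finally show "t * ?r t ^ Suc m + (- t) * ?r (- t) ^ Suc m \<le> \<epsilon> * real (Suc m) * ?h t" .
  qed
  moreover have "integral {1..?b} (\<lambda>t. t * ?r t ^ Suc m) \<le> integral {1..?b} (\<lambda>t. ?b)"
  proof (intro integral_le integrable_continuous_interval continuous_intros)
    fix t assume t: "t \<in> {1..?b}"
    \<comment> \<open>On the cap \<open>t\<close> and \<kappa> are at least 1, so the cubic term
      dominates and the radius is at most 1.\<close>
    have "1 * t \<le> \<kappa> * t ^ 3" using t assms power_increasing[of 1 3 t] by (intro mult_mono) auto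
    then have "\<epsilon> * (t - \<kappa> * t ^ 3) \<le> 0" using assms by (intro mult_nonneg_nonpos) auto
    then have "?r t \<le> 1" using t by (simp add: profile_def max_absorb2)
    then have "?r t ^ Suc m \<le> 1"
      using profile_bounds(2)[of \<epsilon> \<kappa> t] assms t by (intro power_le_one) auto
    then have "t * ?r t ^ Suc m \<le> ?b * 1"
      using t profile_bounds(2)[of \<epsilon> \<kappa> t] assms by (intro mult_mono) (auto intro!: zero_le_power simp del: power_Suc)
    then show "t * ?r t ^ Suc m \<le> ?b" by simp
  qed
  moreover have "integral {-1..?b} (\<lambda>t. t * ?r t ^ Suc m) =
      integral {0..1} (\<lambda>t. t * ?r t ^ Suc m + (- t) * ?r (- t) ^ Suc m) + integral {1..?b} (\<lambda>t. t * ?r t ^ Suc m)"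
    using assms by (intro integral_symmetric_split continuous_intros) auto
  moreover have "integral {0..1} (\<lambda>t. \<epsilon> * real (Suc m) * ?h t) = \<epsilon> * (real (Suc m) * integral {0..1} ?h)"
    by simp
  moreover have "integral {1..?b} (\<lambda>t. ?b) = \<epsilon> * (\<beta> * ?b)" using assms by simp
  ultimately show ?thesis unfolding distrib_left by linarith
qed

section \<open>Choice of the parameters\<close>

lemma profile_exists_nonpos:
  assumes "0 < k"
  obtains \<kappa> \<epsilon> b where "0 < b" "0 \<le> \<kappa>" "0 \<le> \<epsilon>"
    "\<And>t. t \<in> {-1..b} \<Longrightarrow> 0 < profile \<kappa> \<epsilon> t"
    "integral {-1..b} (\<lambda>t. t * profile \<kappa> \<epsilon> t ^ (k + 3)) < 0"
    "\<And>u. 0 \<le> u \<Longrightarrow> 0 < section_moment (k + 2) (profile \<kappa> \<epsilon>) (-1) b u"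
proof -
  obtain \<eta> where \<eta>: "0 < \<eta>" "\<eta> \<le> 2 / 3"
    and L: "\<And>u. u \<in> {0..16} \<Longrightarrow>
      0 < real (k + 2) * integral {0..1} (\<lambda>t. t * (2 * t - (10 / 3 + \<eta>) * t ^ 3) * hpow k (1 - u * t\<^sup>2))
        + (real (k + 2) + 1 / 2) * \<eta> / 5 * hpow (k + 2) (1 - u)"
    using first_order_functional_pos[OF assms] by blast
  define \<kappa> where "\<kappa> = 10 / 3 + \<eta>"
  define \<beta> where "\<beta> = (real (k + 2) + 1 / 2) * \<eta> / 5"
  have \<beta>: "0 < \<beta>" using \<eta> by (simp add: \<beta>_def)
  have \<kappa>: "10 / 3 \<le> \<kappa>" "\<kappa> \<le> 4" using \<eta> by (auto simp: \<kappa>_def)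
  \<comment> \<open>\<Phi> and \<Psi> are the bounds of \<open>section_moment_lower\<close> and
    \<open>body_moment_upper\<close> after division by \<epsilon>; only their signs at \<epsilon> =
    0 have to be known.\<close>
  define \<Phi> where "\<Phi> = (\<lambda>(\<epsilon>, u). real (k + 2) / 2 * integral {0..1}
        (\<lambda>t. t * (2 * t - \<kappa> * t ^ 3) * (2 - \<epsilon> * \<kappa> * t ^ 3) * hpow k ((1 - \<epsilon> * t)\<^sup>2 - u * t\<^sup>2))
      + \<beta> * hpow (k + 2) ((1 - 8 * \<kappa> * \<epsilon>)\<^sup>2 - u * (1 + \<epsilon> * \<beta>)\<^sup>2))"
  define \<Psi> where "\<Psi> = (\<lambda>\<epsilon>. real (k + 3) * integral {0..1} (\<lambda>t. t * (2 * t - \<kappa> * t ^ 3) * (1 + \<epsilon> * (t - \<kappa> * t ^ 3)) ^ (k + 2))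
       + \<beta> * (1 + \<epsilon> * \<beta>))"
  have "continuous_on ({0..1} \<times> {0..16}) \<Phi>"
    unfolding \<Phi>_def case_prod_beta
    by (intro continuous_intros integral_continuous_on_param[where a = "0::real" and b = 1, simplified])
      (auto simp: case_prod_beta intro!: continuous_intros)
  moreover have "0 < \<Phi> (0, u)" if "u \<in> {0..16}" for u
  proof -
    have "(\<lambda>t. t * (2 * t - \<kappa> * t ^ 3) * (2 - 0 * \<kappa> * t ^ 3) * hpow k ((1 - 0 * t)\<^sup>2 - u * t\<^sup>2)) =
      (\<lambda>t. 2 * (t * (2 * t - \<kappa> * t ^ 3) * hpow k (1 - u * t\<^sup>2)))"
      by (simp add: fun_eq_iff)
    then have "\<Phi> (0, u) = real (k + 2) * integral {0..1} (\<lambda>t. t * (2 * t - \<kappa> * t ^ 3) * hpow k (1 - u * t\<^sup>2))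
        + \<beta> * hpow (k + 2) (1 - u)"
      unfolding \<Phi>_def case_prod_conv by (simp only: integral_mult_right) simp
    then show ?thesis using L[OF that] by (simp add: \<kappa>_def \<beta>_def)
  qed
  ultimately obtain \<delta>1 where \<delta>1: "0 < \<delta>1"
    "\<And>\<epsilon> u. 0 \<le> \<epsilon> \<Longrightarrow> \<epsilon> \<le> 1 \<Longrightarrow> \<epsilon> < \<delta>1 \<Longrightarrow> u \<in> {0..16} \<Longrightarrow> 0 < \<Phi> (\<epsilon>, u)"
    using positive_tube[of 16 \<Phi>] by auto
  \<comment> \<open>The tube lemma for a function of \<epsilon> alone: the second parameter ranges
    over the single point 0.\<close>
  have \<Psi>: "continuous_on ({0..1} \<times> {0..0::real}) (\<lambda>p. - \<Psi> (fst p))"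
    unfolding \<Psi>_def
    by (intro continuous_intros integral_continuous_on_param[where a = "0::real" and b = 1, simplified])
      (auto simp: case_prod_beta intro!: continuous_intros)
  have \<Psi>0: "0 < - \<Psi> 0"
  proof -
    have "(\<lambda>t. t * (2 * t - \<kappa> * t ^ 3) * (1 + 0 * (t - \<kappa> * t ^ 3)) ^ (k + 2)) = (\<lambda>t. 2 * t\<^sup>2 - \<kappa> * t ^ 4)"
      by (simp add: fun_eq_iff algebra_simps power2_eq_square power3_eq_cube power4_eq_xxxx)
    then have "\<Psi> 0 = real (k + 3) * (2 / 3 - \<kappa> / 5) + \<beta>"
      unfolding \<Psi>_def by (simp only: integral_poly_2_4) simp
    \<comment> \<open>The first term is - (k + 3) \<eta> / 5 and \<beta> is (k + 5/2) \<eta> / 5: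
      the spare half leaves the centroid on the negative side.\<close>
    also have "\<dots> = - (\<eta> / 10)" by (simp add: \<kappa>_def \<beta>_def field_simps)
    finally show ?thesis using \<eta> by simp
  qed
  obtain \<delta>2 where \<delta>2: "0 < \<delta>2"
    "\<And>\<epsilon> u. 0 \<le> \<epsilon> \<Longrightarrow> \<epsilon> \<le> 1 \<Longrightarrow> \<epsilon> < \<delta>2 \<Longrightarrow> u \<in> {0..0::real} \<Longrightarrow> 0 < - \<Psi> (fst (\<epsilon>, u))"
    by (rule positive_tube[OF \<Psi>]) (use \<Psi>0 in auto)
  \<comment> \<open>The first two terms put \<epsilon> below both tube widths; 1 / (16 \<kappa>)
    ensures 8 \<kappa> \<epsilon> \<le> 1/2, and 1 / \<beta> keeps the right end of the body at most
    2.\<close>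
  define \<epsilon> where "\<epsilon> = min (min (\<delta>1 / 2) (\<delta>2 / 2)) (min (1 / (16 * \<kappa>)) (1 / \<beta>))"
  have \<epsilon>: "0 < \<epsilon>" "\<epsilon> < \<delta>1" "\<epsilon> < \<delta>2" "\<epsilon> \<le> 1 / (16 * \<kappa>)" "\<epsilon> \<le> 1 / \<beta>"
    using \<delta>1(1) \<delta>2(1) \<kappa> \<beta> by (auto simp: \<epsilon>_def)
  have "1 / (16 * \<kappa>) \<le> 1" using \<kappa> by (simp add: field_simps)
  then have \<epsilon>1: "\<epsilon> \<le> 1" using \<epsilon> by simp
  have \<epsilon>\<kappa>: "8 * \<kappa> * \<epsilon> \<le> 1 / 2" and \<epsilon>\<beta>: "\<epsilon> * \<beta> \<le> 1" and \<epsilon>\<beta>0: "0 \<le> \<epsilon> * \<beta>"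
    using \<epsilon> \<kappa> \<beta> by (auto simp: field_simps)
  show ?thesis
  proof (rule that[of "1 + \<epsilon> * \<beta>" \<kappa> \<epsilon>])
    show "0 < profile \<kappa> \<epsilon> t" if "t \<in> {-1..1 + \<epsilon> * \<beta>}" for t
      using that \<epsilon>\<beta> \<epsilon> \<kappa> \<epsilon>\<kappa> by (intro profile_bounds) auto
    have "\<epsilon> * \<Psi> \<epsilon> < 0" using \<delta>2(2)[of \<epsilon> 0] \<epsilon> \<epsilon>1 by (simp add: mult_less_0_iff)
    then show "integral {-1..1 + \<epsilon> * \<beta>} (\<lambda>t. t * profile \<kappa> \<epsilon> t ^ (k + 3)) < 0"
      using body_moment_upper[of \<epsilon> \<kappa> \<beta> "k + 2"] \<epsilon> \<kappa> \<epsilon>\<kappa> \<epsilon>\<beta> \<epsilon>\<beta>0 by (simp add: \<Psi>_def eval_nat_numeral)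
    fix u :: real assume u: "0 \<le> u"
    show "0 < section_moment (k + 2) (profile \<kappa> \<epsilon>) (-1) (1 + \<epsilon> * \<beta>) u"
    proof (cases "u \<le> 16")
      case True
      then have "0 < \<epsilon> * \<Phi> (\<epsilon>, u)" using \<delta>1(2)[of \<epsilon> u] \<epsilon> \<epsilon>1 u by simp
      also have "\<dots> \<le> section_moment (k + 2) (profile \<kappa> \<epsilon>) (-1) (1 + \<epsilon> * \<beta>) u"
        unfolding \<Phi>_def case_prod_conv
        using \<epsilon> \<kappa> \<epsilon>\<kappa> \<epsilon>\<beta> \<epsilon>\<beta>0 u assms by (intro section_moment_lower) auto
      finally show ?thesis .
    next
      case False
      then show ?thesis using \<epsilon> \<kappa> \<epsilon>\<kappa> \<epsilon>\<beta> \<epsilon>\<beta>0 by (intro section_moment_pos_large) auto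
    qed
  qed (use \<epsilon> \<kappa> \<epsilon>\<beta>0 in auto)
qed

text \<open>As the left end moves from -1 to 0 the axial moment passes from negative to positive, so
  it vanishes at some cut \<open>x\<close>. The removed slice has t \<le> 0 and contributes
  nonpositively to each section moment, so these stay positive.\<close>

lemma profile_exists:
  assumes "0 < k"
  obtains r a b where "0 < a" "0 < b" "concave_on UNIV r" "continuous_on UNIV r"
    "\<And>t. t \<in> {-a..b} \<Longrightarrow> 0 < r t"
    "integral {-a..b} (\<lambda>t. t * r t ^ (k + 3)) = 0"
    "\<And>u. 0 \<le> u \<Longrightarrow> 0 < section_moment (k + 2) r (-a) b u"
proof -
  obtain \<kappa> \<epsilon> b where b: "0 < b" and \<kappa>\<epsilon>: "0 \<le> \<kappa>" "0 \<le> \<epsilon>"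
    and pos: "\<And>t. t \<in> {-1..b} \<Longrightarrow> 0 < profile \<kappa> \<epsilon> t"
    and C: "integral {-1..b} (\<lambda>t. t * profile \<kappa> \<epsilon> t ^ (k + 3)) < 0"
    and F: "\<And>u. 0 \<le> u \<Longrightarrow> 0 < section_moment (k + 2) (profile \<kappa> \<epsilon>) (-1) b u"
    by (rule profile_exists_nonpos[OF assms]) (rule that)
  let ?r = "profile \<kappa> \<epsilon>"
  let ?G = "\<lambda>x. integral {x..b} (\<lambda>t. t * ?r t ^ (k + 3))"
  have "continuous_on {-1..b} ?G"
    by (intro indefinite_integral_continuous_1' integrable_continuous_interval continuous_intros)
  then have "continuous_on {-1..0} ?G" by (rule continuous_on_subset) (use b in auto)
  moreover have "0 < ?G 0"
  proof (rule integral_pos[of 0 b _ b])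
    show "0 \<le> t * ?r t ^ (k + 3)" if "t \<in> {0..b}" for t
      using pos[of t] that by (intro mult_nonneg_nonneg zero_le_power) auto
  qed (use b pos[of b] in \<open>auto intro!: continuous_intros\<close>)
  ultimately obtain x where x: "-1 \<le> x" "x \<le> 0" "?G x = 0"
    using IVT'[of ?G "-1" 0 0] C by auto
  have "x \<noteq> 0" using x \<open>0 < ?G 0\<close> by auto
  show ?thesis
  proof (rule that[of "-x" b ?r])
    show "integral {- (- x)..b} (\<lambda>t. t * ?r t ^ (k + 3)) = 0" using x by simp
    fix u :: real assume u: "0 \<le> u"
    have "section_moment (k + 2) ?r (-1) x u + section_moment (k + 2) ?r x b u = section_moment (k + 2) ?r (-1) b u"
      unfolding section_moment_def using x b
      by (intro Henstock_Kurzweil_Integration.integral_combine integrable_continuous_interval continuous_intros) auto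
    moreover have "0 \<le> integral {-1..x} (\<lambda>t. - (t * hpow (k + 2) ((?r t)\<^sup>2 - u * t\<^sup>2)))"
      using x by (intro integral_nonneg integrable_continuous_interval continuous_intros)
       (auto intro!: mult_nonpos_nonneg hpow_nonneg)
    then have "section_moment (k + 2) ?r (-1) x u \<le> 0" by (simp add: section_moment_def)
    ultimately show "0 < section_moment (k + 2) ?r (- (- x)) b u" using F[OF u] by simp
  qed (use x b pos \<kappa>\<epsilon> \<open>x \<noteq> 0\<close> in \<open>auto intro!: concave_on_profile continuous_intros\<close>)
qed

section \<open>Bodies of revolution\<close>

text \<open>Extends the ball volume to squared radii that are zero or negative. Nonemptiness of
  \<open>W\<close> matters for \<open>q < 0\<close>, where the set is empty but
  \<open>hpow 0 q = 1\<close>.\<close>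

lemma emeasure_PiM_lborel_ball:
  assumes "finite W" "W \<noteq> {}"
  shows "emeasure (\<Pi>\<^sub>M b\<in>W. lborel) {f \<in> space (\<Pi>\<^sub>M b\<in>W. lborel). (\<Sum>b\<in>W. (f b)\<^sup>2) \<le> q}
    = ennreal (unit_ball_vol (card W) * hpow (card W) q)"
proof -
  let ?P = "\<Pi>\<^sub>M b\<in>W. lborel :: real measure"
  let ?S = "\<lambda>q. {f \<in> space ?P. (\<Sum>b\<in>W. (f b)\<^sup>2) \<le> q}"
  have card: "0 < card W" using assms by (simp add: card_gt_0_iff)
  have nonneg: "0 \<le> (\<Sum>b\<in>W. (f b)\<^sup>2)" for f :: "'a \<Rightarrow> real" by (intro sum_nonneg) auto
  have pos: "emeasure ?P (?S q) = ennreal (unit_ball_vol (card W) * hpow (card W) q)" if "0 < q" for q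
  proof -
    have "?S q = {f. sqrt (\<Sum>b\<in>W. (f b)\<^sup>2) \<le> sqrt q} \<inter> space ?P" by auto
    then show ?thesis
      using emeasure_cball_aux[OF assms(1), of "sqrt q"] that by (simp add: hpow_def max_absorb2)
  qed
  consider "0 < q" | "q = 0" | "q < 0" by linarith
  then show ?thesis
  proof cases
    case 1 then show ?thesis by (rule pos)
  next
    \<comment> \<open>The degenerate ball lies in every ball of positive radius, and their volumes
      tend to 0.\<close>
    case 2
    have "continuous_on UNIV (hpow (card W))" using continuous_on_hpow[OF continuous_on_id] by simp
    then have "hpow (card W) \<midarrow>0\<rightarrow> hpow (card W) 0" by (simp add: continuous_on_def)
    then have "(hpow (card W) \<longlongrightarrow> hpow (card W) 0) (at_right 0)"
      by (rule tendsto_mono[OF at_le[OF subset_UNIV]])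
    then have "((\<lambda>q. ennreal (unit_ball_vol (card W) * hpow (card W) q)) \<longlongrightarrow> ennreal (unit_ball_vol (card W) * hpow (card W) 0)) (at_right 0)"
      by (intro tendsto_ennrealI tendsto_mult tendsto_const)
    moreover have "eventually (\<lambda>q. emeasure ?P (?S 0) \<le> ennreal (unit_ball_vol (card W) * hpow (card W) q)) (at_right 0)"
      unfolding eventually_at_filter
      by (intro always_eventually) (auto simp flip: pos intro!: emeasure_mono)
    ultimately have "emeasure ?P (?S 0) \<le> ennreal (unit_ball_vol (card W) * hpow (card W) 0)"
      by (rule tendsto_lowerbound) simp
    then show ?thesis using 2 card by (simp add: hpow_nonpos)
  next
    case 3
    then have "?S q = {}" using nonneg by (auto simp: not_le intro: less_le_trans)
    then show ?thesis using 3 card by (simp only: emeasure_empty) (simp add: hpow_nonpos)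
  qed
qed

lemma emeasure_onb_lborel_finite:
  fixes B :: "'a::euclidean_space set"
  assumes B: "pairwise orthogonal B" "\<And>b. b \<in> B \<Longrightarrow> norm b = 1" "B \<noteq> {}"
    and K: "bounded K" "K \<in> sets borel"
  shows "emeasure (onb_lborel B) K < \<infinity>"
proof -
  have fin: "finite B" using orthonormal_finite[OF B(1,2)] by simp
  obtain R where R: "0 < R" "K \<subseteq> cball 0 R"
    using bounded_subset_ballD[OF K(1), of 0] ball_subset_cball by blast
  have "emeasure (onb_lborel B) K \<le> emeasure (onb_lborel B) (cball 0 R)"
    using R by (intro emeasure_mono) auto
  also have "\<dots> = emeasure (\<Pi>\<^sub>M b\<in>B. lborel) {f \<in> space (\<Pi>\<^sub>M b\<in>B. lborel). (\<Sum>b\<in>B. (f b)\<^sup>2) \<le> R\<^sup>2}"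
  proof (subst emeasure_onb_lborel)
    have "sqrt (\<Sum>b\<in>B. (f b)\<^sup>2) \<le> R \<longleftrightarrow> (\<Sum>b\<in>B. (f b)\<^sup>2) \<le> R\<^sup>2" for f :: "'a \<Rightarrow> real"
      using R(1) real_sqrt_le_iff[of "\<Sum>b\<in>B. (f b)\<^sup>2" "R\<^sup>2"] by simp
    then show "emeasure (\<Pi>\<^sub>M b\<in>B. lborel) {f \<in> space (\<Pi>\<^sub>M b\<in>B. lborel). (\<Sum>b\<in>B. f b *\<^sub>R b) \<in> cball 0 R}
      = emeasure (\<Pi>\<^sub>M b\<in>B. lborel) {f \<in> space (\<Pi>\<^sub>M b\<in>B. lborel). (\<Sum>b\<in>B. (f b)\<^sup>2) \<le> R\<^sup>2}"
      by (simp add: sum_orthonormal_norm[OF B(1,2)])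
  qed simp
  also have "\<dots> < \<infinity>" unfolding emeasure_PiM_lborel_ball[OF fin B(3)] by simp
  finally show ?thesis .
qed

lemma integrable_onb_lborel:
  fixes B :: "'a::euclidean_space set" and g :: "'a \<Rightarrow> 'b::{banach, second_countable_topology}"
  assumes B: "pairwise orthogonal B" "\<And>b. b \<in> B \<Longrightarrow> norm b = 1" "B \<noteq> {}"
    and K: "bounded K" "K \<in> sets borel" and g: "continuous_on UNIV g" "bounded (g ` K)"
  shows "integrable (onb_lborel B) (\<lambda>x. indicator K x *\<^sub>R g x)"
proof -
  obtain M where "\<And>x. x \<in> K \<Longrightarrow> norm (g x) \<le> M" using g(2) by (auto simp: bounded_iff)
  then show ?thesis
    using emeasure_onb_lborel_finite[OF B K] K borel_measurable_continuous_onI[OF g(1)]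
    by (intro integrableI_bounded_set_indicator) (auto simp: measurable_def)
qed

section \<open>The body of revolution and its convexity\<close>

definition rev_body :: "'a::euclidean_space \<Rightarrow> (real \<Rightarrow> real) \<Rightarrow> real \<Rightarrow> real \<Rightarrow> 'a set" where
  "rev_body e r a b = {x. x \<bullet> e \<in> {a..b} \<and> norm (x - (x \<bullet> e) *\<^sub>R e) \<le> r (x \<bullet> e)}"

lemma norm_minus_proj:
  assumes "norm e = 1"
  shows "(norm (x - (x \<bullet> e) *\<^sub>R e))\<^sup>2 = (norm x)\<^sup>2 - (x \<bullet> e)\<^sup>2"
  using assms unfolding power2_norm_eq_inner norm_eq_1
  by (simp add: inner_diff_left inner_diff_right inner_commute power2_eq_square)

lemma closed_rev_body: "continuous_on UNIV r \<Longrightarrow> closed (rev_body e r a b)"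
proof -
  assume r: "continuous_on UNIV r"
  have "closed {x. a \<le> x \<bullet> e \<and> x \<bullet> e \<le> b \<and> norm (x - (x \<bullet> e) *\<^sub>R e) \<le> r (x \<bullet> e)}"
    by (intro closed_Collect_conj closed_Collect_le continuous_intros continuous_on_compose2[OF r]) auto
  then show ?thesis by (simp add: rev_body_def conj_assoc)
qed

lemma bounded_rev_body:
  assumes "continuous_on UNIV r" "norm e = 1"
  shows "bounded (rev_body e r a b)"
proof -
  have "bounded (r ` {a..b})"
    using assms(1) by (intro compact_imp_bounded compact_continuous_image) (auto intro: continuous_on_subset)
  then obtain M where M: "\<forall>t\<in>{a..b}. \<bar>r t\<bar> \<le> M" by (auto simp: bounded_iff)
  have "norm x \<le> M + (\<bar>a\<bar> + \<bar>b\<bar>)" if "x \<in> rev_body e r a b" for x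
  proof -
    have "norm x \<le> norm (x - (x \<bullet> e) *\<^sub>R e) + norm ((x \<bullet> e) *\<^sub>R e)"
      using norm_triangle_ineq[of "x - (x \<bullet> e) *\<^sub>R e" "(x \<bullet> e) *\<^sub>R e"] by simp
    also have "\<dots> \<le> M + (\<bar>a\<bar> + \<bar>b\<bar>)"
      using that M[rule_format, of "x \<bullet> e"] assms(2) by (intro add_mono) (auto simp: rev_body_def)
    finally show ?thesis .
  qed
  then show ?thesis by (auto simp: bounded_iff)
qed

lemma convex_body_rev_body:
  fixes e :: "'a::euclidean_space"
  assumes r: "continuous_on UNIV r" "concave_on UNIV r" "\<And>t. t \<in> {-a..b} \<Longrightarrow> 0 < r t"
    and e: "norm e = 1" and ab: "0 < a" "0 < b"
  shows "convex_body (rev_body e r (-a) b)"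
  unfolding convex_body_def
proof (intro conjI)
  show "compact (rev_body e r (-a) b)"
    by (simp add: compact_eq_bounded_closed closed_rev_body bounded_rev_body r e)
  show "convex (rev_body e r (-a) b)"
  proof (rule convexI)
    fix x y and s t :: real
    assume xy: "x \<in> rev_body e r (-a) b" "y \<in> rev_body e r (-a) b" and st: "0 \<le> s" "0 \<le> t" "s + t = 1"
    let ?z = "s *\<^sub>R x + t *\<^sub>R y"
    have z: "?z \<bullet> e = s * (x \<bullet> e) + t * (y \<bullet> e)" by (simp add: inner_add_left)
    have "?z - (?z \<bullet> e) *\<^sub>R e = s *\<^sub>R (x - (x \<bullet> e) *\<^sub>R e) + t *\<^sub>R (y - (y \<bullet> e) *\<^sub>R e)"
      by (simp add: z algebra_simps)
    then have "norm (?z - (?z \<bullet> e) *\<^sub>R e) \<le> s * norm (x - (x \<bullet> e) *\<^sub>R e) + t * norm (y - (y \<bullet> e) *\<^sub>R e)"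
      using norm_triangle_ineq[of "s *\<^sub>R (x - (x \<bullet> e) *\<^sub>R e)" "t *\<^sub>R (y - (y \<bullet> e) *\<^sub>R e)"] st by simp
    also have "\<dots> \<le> s * r (x \<bullet> e) + t * r (y \<bullet> e)"
      using xy st by (intro add_mono mult_left_mono) (auto simp: rev_body_def)
    also have "\<dots> \<le> r (?z \<bullet> e)"
    proof -
      have s: "s = 1 - t" using st by simp
      show ?thesis using concave_onD[OF r(2), of t "x \<bullet> e" "y \<bullet> e"] st unfolding z unfolding s by simp
    qed
    finally have "norm (?z - (?z \<bullet> e) *\<^sub>R e) \<le> r (?z \<bullet> e)" .
    moreover have "?z \<bullet> e \<in> {-a..b}"
      using convexD[of "{-a..b}" "x \<bullet> e" "y \<bullet> e" s t] xy st unfolding z by (simp add: rev_body_def)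
    ultimately show "?z \<in> rev_body e r (-a) b" by (simp add: rev_body_def)
  qed
  have "continuous_on {-a..b} r" using r(1) by (rule continuous_on_subset) simp
  then obtain t0 where t0: "t0 \<in> {-a..b}" "\<And>t. t \<in> {-a..b} \<Longrightarrow> r t0 \<le> r t"
    using continuous_attains_inf[of "{-a..b}" r] ab by auto
  \<comment> \<open>The least radius and the distances from the origin to both ends: a ball this
    small about the origin meets every constraint.\<close>
  let ?d = "min (r t0) (min a b)"
  have "ball (0::'a) ?d \<subseteq> rev_body e r (-a) b"
  proof
    fix x :: 'a assume "x \<in> ball 0 ?d"
    then have x: "norm x < ?d" by simp
    have "\<bar>x \<bullet> e\<bar> \<le> norm x" using Cauchy_Schwarz_ineq2[of x e] e by simp
    then have xe: "x \<bullet> e \<in> {-a..b}" using x by auto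
    have "(norm (x - (x \<bullet> e) *\<^sub>R e))\<^sup>2 \<le> (norm x)\<^sup>2" by (simp add: norm_minus_proj[OF e])
    then have "norm (x - (x \<bullet> e) *\<^sub>R e) \<le> norm x" by (rule power2_le_imp_le) simp
    also have "\<dots> \<le> r (x \<bullet> e)" using x t0(2)[OF xe] by simp
    finally show "x \<in> rev_body e r (-a) b" using xe by (simp add: rev_body_def)
  qed
  then have "0 \<in> interior (rev_body e r (-a) b)"
    using r(3)[OF t0(1)] ab by (auto simp: mem_interior intro!: exI[of _ ?d])
  then show "interior (rev_body e r (-a) b) \<noteq> {}" by auto
qed

text \<open>Fubini with the coordinate along \<zeta> outside: each slice is a ball in the span of
  \<open>W\<close>, and only \<zeta> has a component along \<open>e\<close>. Taking \<zeta> as the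
  normalised projection of the axis gives a section; taking \<zeta> = e gives the whole
  body.\<close>

lemma moment_rev_body:
  fixes W :: "'a::euclidean_space set"
  assumes B: "pairwise orthogonal (insert \<zeta> W)" "\<And>b. b \<in> insert \<zeta> W \<Longrightarrow> norm b = 1" "\<zeta> \<notin> W" "W \<noteq> {}"
    and e: "norm e = 1" "\<And>w. w \<in> W \<Longrightarrow> w \<bullet> e = 0" and z: "0 < \<zeta> \<bullet> e"
    and r: "continuous_on UNIV r" "\<And>t. t \<in> {-a..b} \<Longrightarrow> 0 < r t" and ab: "0 < a" "0 < b"
  shows "(LINT x:rev_body e r (-a) b|onb_lborel (insert \<zeta> W). x) \<bullet> e =
    unit_ball_vol (card W) / (\<zeta> \<bullet> e) * section_moment (card W) r (-a) b ((1 - (\<zeta> \<bullet> e)\<^sup>2) / (\<zeta> \<bullet> e)\<^sup>2)"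
proof -
  let ?P = "\<lambda>B::'a set. \<Pi>\<^sub>M b\<in>B. lborel :: real measure"
  let ?K = "rev_body e r (-a) b" and ?v = "unit_ball_vol (card W)"
  define z where "z = \<zeta> \<bullet> e"
  have z0: "0 < z" using z by (simp add: z_def)
  have fin: "finite W" using orthonormal_finite[OF B(1,2)] by simp
  have W: "pairwise orthogonal W" "\<And>b. b \<in> W \<Longrightarrow> norm b = 1"
    using B by (auto simp: pairwise_insert)
  have meas_r [measurable]: "r \<in> borel_measurable borel" using r(1) by (rule borel_measurable_continuous_onI)
  have K: "bounded ?K" "?K \<in> sets borel"
    using bounded_rev_body[OF r(1) e(1)] borel_closed[OF closed_rev_body[OF r(1)]] by auto
  note [measurable] = K(2)
  have int: "integrable (onb_lborel (insert \<zeta> W)) (\<lambda>x. indicator ?K x *\<^sub>R x)"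
    using K by (intro integrable_onb_lborel B) (auto intro: continuous_on_id)
  \<comment> \<open>By Pythagoras a point y \<zeta> + w, with w in the span of \<open>W\<close>, has
    squared distance |w|^2 + (1 - z^2) y^2 from the axis. So \<open>q y\<close> is the squared
    radius of the slice at \<open>y\<close>.\<close>
  define q where "q y = (r (y * z))\<^sup>2 - (1 - z\<^sup>2) * y\<^sup>2" for y
  have [measurable]: "q \<in> borel_measurable borel" unfolding q_def by measurable
  define g where "g f y = indicator {-a..b} (y * z) * indicator {f. (\<Sum>b\<in>W. (f b)\<^sup>2) \<le> q y} f * (y * z)"
    for f :: "'a \<Rightarrow> real" and y
  have sumW: "(\<Sum>b\<in>W. f b *\<^sub>R b) \<bullet> e = 0" for f
    using e(2) by (simp add: inner_sum_left)
  have inner: "(\<Sum>b\<in>insert \<zeta> W. f b *\<^sub>R b) \<bullet> e = f \<zeta> * z" for f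
    using fin B(3) sumW[of f] by (simp add: inner_add_left z_def)
  have point: "indicator ?K (\<Sum>b\<in>insert \<zeta> W. f b *\<^sub>R b) * ((\<Sum>b\<in>insert \<zeta> W. f b *\<^sub>R b) \<bullet> e) = g f (f \<zeta>)" for f
  proof -
    let ?x = "\<Sum>b\<in>insert \<zeta> W. f b *\<^sub>R b"
    have nx: "(norm ?x)\<^sup>2 = (f \<zeta>)\<^sup>2 + (\<Sum>b\<in>W. (f b)\<^sup>2)"
      using sum_orthonormal_norm[OF B(1,2), of f] fin B(3) by (simp add: sum_nonneg add_nonneg_nonneg)
    have "?x \<in> ?K \<longleftrightarrow> f \<zeta> * z \<in> {-a..b} \<and> (\<Sum>b\<in>W. (f b)\<^sup>2) \<le> q (f \<zeta>)"
    proof (cases "f \<zeta> * z \<in> {-a..b}")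
      case True
      have "norm (?x - (?x \<bullet> e) *\<^sub>R e) \<le> r (f \<zeta> * z) \<longleftrightarrow> (norm (?x - (?x \<bullet> e) *\<^sub>R e))\<^sup>2 \<le> (r (f \<zeta> * z))\<^sup>2"
        using r(2)[OF True] abs_le_square_iff[of "norm (?x - (?x \<bullet> e) *\<^sub>R e)" "r (f \<zeta> * z)"] by simp
      also have "\<dots> \<longleftrightarrow> (\<Sum>b\<in>W. (f b)\<^sup>2) \<le> q (f \<zeta>)"
        by (subst norm_minus_proj[OF e(1)]) (simp only: nx inner q_def, simp add: algebra_simps power_mult_distrib)
      finally show ?thesis using True by (simp add: rev_body_def inner)
    qed (auto simp: rev_body_def inner)
    then show ?thesis unfolding inner g_def by (simp split: split_indicator)
  qed
  have "(LINT x:?K|onb_lborel (insert \<zeta> W). x) \<bullet> e = (LINT x|onb_lborel (insert \<zeta> W). indicator ?K x * (x \<bullet> e))"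
    unfolding set_lebesgue_integral_def using int by (subst integral_inner_left[symmetric]) auto
  also have "\<dots> = (LINT f|?P (insert \<zeta> W). g f (f \<zeta>))"
    unfolding onb_lborel_def by (subst integral_distr) (auto simp: point)
  also have "\<dots> = (LINT f|?P W. (LINT y|lborel. g (f(\<zeta> := y)) ((f(\<zeta> := y)) \<zeta>)))"
  proof (rule lborel_product.product_integral_insert[OF fin B(3)])
    have "integrable (onb_lborel (insert \<zeta> W)) (\<lambda>x. indicator ?K x * (x \<bullet> e))"
      using integrable_inner_left[OF int, of e] by simp
    then show "integrable (?P (insert \<zeta> W)) (\<lambda>f. g f (f \<zeta>))"
      unfolding onb_lborel_def by (subst (asm) integrable_distr_eq) (auto simp: point)
  qed
  also have "\<dots> = (LINT f|?P W. (LINT y|lborel. g f y))"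
  proof -
    have "(\<Sum>b\<in>W. ((f(\<zeta> := y)) b)\<^sup>2) = (\<Sum>b\<in>W. (f b)\<^sup>2)" for f :: "'a \<Rightarrow> real" and y
      using B(3) by (intro sum.cong) auto
    then have "g (f(\<zeta> := y)) ((f(\<zeta> := y)) \<zeta>) = g f y" for f y
      by (simp add: g_def indicator_def)
    then show ?thesis by simp
  qed
  also have "\<dots> = (LINT y|lborel. (LINT f|?P W. g f y))"
  proof (rule pair_sigma_finite.Fubini_integral)
    show "pair_sigma_finite lborel (?P W)"
      by (intro pair_sigma_finite.intro lborel.sigma_finite_measure_axioms lborel_product.sigma_finite fin)
    have "bounded (r ` {-a..b})"
      using r(1) by (intro compact_imp_bounded compact_continuous_image) (auto intro: continuous_on_subset)
    then obtain M where M: "\<forall>t\<in>{-a..b}. \<bar>r t\<bar> \<le> M" by (auto simp: bounded_iff)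
    let ?S = "{f \<in> space (?P W). (\<Sum>b\<in>W. (f b)\<^sup>2) \<le> M\<^sup>2}"
    have z1: "z\<^sup>2 \<le> 1"
      using Cauchy_Schwarz_ineq2[of \<zeta> e] B(2)[of \<zeta>] e(1) z0 by (simp add: z_def abs_square_le_1)
    have qM: "q y \<le> M\<^sup>2" if "y * z \<in> {-a..b}" for y
    proof -
      have "\<bar>r (y * z)\<bar> \<le> \<bar>M\<bar>" using M[rule_format, OF that] by linarith
      then have "(r (y * z))\<^sup>2 \<le> M\<^sup>2" by (simp only: abs_le_square_iff)
      moreover have "0 \<le> (1 - z\<^sup>2) * y\<^sup>2" using z1 by simp
      ultimately show ?thesis by (simp add: q_def)
    qed
    show "integrable (lborel \<Otimes>\<^sub>M ?P W) (\<lambda>(y, f). g f y)"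
    \<comment> \<open>The integrand vanishes off a product of an interval with a ball of radius
      \<bar>M\<bar>, and the height y z is bounded there by \<open>max a b\<close>.\<close>
    proof (rule integrableI_bounded_set[where A = "{-a / z..b / z} \<times> ?S" and B = "max a b"])
      show "{-a / z..b / z} \<times> ?S \<in> sets (lborel \<Otimes>\<^sub>M ?P W)" by measurable
      show "(\<lambda>(y, f). g f y) \<in> borel_measurable (lborel \<Otimes>\<^sub>M ?P W)"
        unfolding g_def indicator_def by measurable
      have "emeasure (lborel \<Otimes>\<^sub>M ?P W) ({-a / z..b / z} \<times> ?S) = emeasure lborel {-a / z..b / z} * emeasure (?P W) ?S"
        by (intro sigma_finite_measure.emeasure_pair_measure_Times lborel_product.sigma_finite fin) auto
      also have "\<dots> < \<infinity>"
        unfolding emeasure_PiM_lborel_ball[OF fin B(4)]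
        using emeasure_compact_finite[OF compact_Icc, of "- a / z" "b / z"]
        by (simp add: ennreal_mult_less_top)
      finally show "emeasure (lborel \<Otimes>\<^sub>M ?P W) ({-a / z..b / z} \<times> ?S) < \<infinity>" .
      show "AE x in lborel \<Otimes>\<^sub>M ?P W. x \<in> {-a / z..b / z} \<times> ?S \<longrightarrow> norm (case x of (y, f) \<Rightarrow> g f y) \<le> max a b"
        using ab by (intro AE_I2) (auto simp: g_def split: split_indicator)
      show "AE x in lborel \<Otimes>\<^sub>M ?P W. x \<notin> {-a / z..b / z} \<times> ?S \<longrightarrow> (case x of (y, f) \<Rightarrow> g f y) = 0"
      proof (intro AE_I2 impI)
        fix x assume x: "x \<in> space (lborel \<Otimes>\<^sub>M ?P W)" "x \<notin> {-a / z..b / z} \<times> ?S"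
        obtain y f where [simp]: "x = (y, f)" by fastforce
        show "(case x of (y, f) \<Rightarrow> g f y) = 0"
        proof (rule ccontr)
          assume "(case x of (y, f) \<Rightarrow> g f y) \<noteq> 0"
          then have *: "y * z \<in> {-a..b}" "(\<Sum>b\<in>W. (f b)\<^sup>2) \<le> q y"
            by (auto simp: g_def split: split_indicator_asm)
          then have "y \<in> {-a / z..b / z}" using z0 by (auto simp: field_simps)
          moreover have "f \<in> ?S" using x(1) *(2) qM[OF *(1)] by (simp add: space_pair_measure)
          ultimately show False using x(2) by simp
        qed
      qed
    qed
  qed
  also have "\<dots> = (LINT y|lborel. indicator {-a..b} (y * z) * (y * z) * (?v * hpow (card W) (q y)))"
  proof (intro Bochner_Integration.integral_cong refl)
    fix y :: real
    let ?S = "{f \<in> space (?P W). (\<Sum>b\<in>W. (f b)\<^sup>2) \<le> q y}"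
    have "(LINT f|?P W. g f y) = (LINT f|?P W. (indicator {-a..b} (y * z) * (y * z)) * indicator ?S f)"
      by (intro Bochner_Integration.integral_cong) (auto simp: g_def split: split_indicator)
    also have "\<dots> = indicator {-a..b} (y * z) * (y * z) * measure (?P W) ?S"
      by (simp add: Int_absorb2)
    also have "measure (?P W) ?S = ?v * hpow (card W) (q y)"
      unfolding measure_def emeasure_PiM_lborel_ball[OF fin B(4)]
      by (intro enn2real_ennreal mult_nonneg_nonneg hpow_nonneg) simp
    finally show "(LINT f|?P W. g f y) = indicator {-a..b} (y * z) * (y * z) * (?v * hpow (card W) (q y))" .
  qed
  \<comment> \<open>Substituting the height t = y z produces the factor 1 / z and turns (1 - z^2)
    y^2 into u t^2.\<close>
  also have "\<dots> = (1 / z) * (LINT t|lborel. indicator {-a..b} t * t * (?v * hpow (card W) ((r t)\<^sup>2 - (1 - z\<^sup>2) / z\<^sup>2 * t\<^sup>2)))"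
    using z0 by (subst lborel_integral_real_affine[of "1 / z" _ 0]) (auto simp: q_def power_divide)
  also have "(LINT t|lborel. indicator {-a..b} t * t * (?v * hpow (card W) ((r t)\<^sup>2 - (1 - z\<^sup>2) / z\<^sup>2 * t\<^sup>2)))
      = ?v * (LINT t:{-a..b}|lborel. t * hpow (card W) ((r t)\<^sup>2 - (1 - z\<^sup>2) / z\<^sup>2 * t\<^sup>2))"
    unfolding set_lebesgue_integral_def by (subst integral_mult_right_zero[symmetric]) (simp add: mult_ac)
  also have "(LINT t:{-a..b}|lborel. t * hpow (card W) ((r t)\<^sup>2 - (1 - z\<^sup>2) / z\<^sup>2 * t\<^sup>2))
      = section_moment (card W) r (-a) b ((1 - z\<^sup>2) / z\<^sup>2)"
    unfolding section_moment_def
    by (intro set_borel_integral_eq_integral borel_integrable_atLeastAtMost' continuous_intros continuous_on_subset[OF r(1)]) simp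
  finally show ?thesis by (simp add: z_def)
qed

section \<open>Centroids of the body and of its sections\<close>

lemma card_orthonormal_basis_of_perp:
  fixes \<xi> :: "'a::euclidean_space"
  assumes "norm \<xi> = 1" "orthonormal_basis_of (perp \<xi>) B"
  shows "card B = DIM('a) - 1" "finite B"
proof -
  note B = orthonormal_basis_of_perp[OF assms]
  show "finite B" using orthonormal_finite[OF B(1,2)] by simp
  then show "card B = DIM('a) - 1" using span_orthonormal_card[OF B(1,2,4)] B(3) by simp
qed

lemma rev_body_centroid:
  fixes e :: "'a::euclidean_space"
  assumes e: "norm e = 1" and dim: "2 \<le> DIM('a)"
    and r: "continuous_on UNIV r" "\<And>t. t \<in> {-a..b} \<Longrightarrow> 0 < r t" and ab: "0 < a" "0 < b"
    and C: "integral {-a..b} (\<lambda>t. t * r t ^ (DIM('a) - 1)) = 0"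
  shows "centroid lborel (rev_body e r (-a) b) = 0"
proof -
  let ?K = "rev_body e r (-a) b"
  obtain W where W: "orthonormal_basis_of (perp e) W"
    using orthonormal_basis_of_exists[OF subspace_perp] by blast
  note B = orthonormal_basis_of_perp[OF e W]
  have card: "card W = DIM('a) - 1" "finite W" using card_orthonormal_basis_of_perp[OF e W] by auto
  then have "W \<noteq> {}" using dim by auto
  have We: "w \<bullet> e = 0" if "w \<in> W" for w
    using that W span_superset[of W] by (auto simp: orthonormal_basis_of_def perp_def)
  have lborel: "onb_lborel (insert e W) = lborel" using B by (intro onb_lborel_eq_lborel) auto
  have ee: "e \<bullet> e = 1" using e by (simp add: norm_eq_1)
  have "section_moment (card W) r (-a) b 0 = integral {-a..b} (\<lambda>t. t * r t ^ (DIM('a) - 1))"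
    unfolding section_moment_def card(1)
    using r(2) by (intro integral_cong) (simp add: hpow_power2 less_imp_le)
  then have "(LINT x:?K|lborel. x) \<bullet> e = 0"
    using moment_rev_body[OF B(1,2,3) \<open>W \<noteq> {}\<close> e We _ r ab] C by (simp add: lborel ee)
  \<comment> \<open>The map \<open>?T\<close> fixes the axis, negates its orthogonal complement and
    preserves the body, so it fixes the moment vector. A fixed vector with zero axial coordinate
    equals its own negative.\<close>
  moreover have "(LINT x:?K|lborel. x) = (2 * ((LINT x:?K|lborel. x) \<bullet> e)) *\<^sub>R e - (LINT x:?K|lborel. x)"
  proof -
    let ?T = "\<lambda>x. (2 * (x \<bullet> e)) *\<^sub>R e - x"
    have T_inner: "?T x \<bullet> e = x \<bullet> e" for x by (simp add: inner_diff_left ee)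
    have T_proj: "?T x - (x \<bullet> e) *\<^sub>R e = - (x - (x \<bullet> e) *\<^sub>R e)" for x
      by (simp add: algebra_simps scaleR_2 flip: scaleR_scaleR)
    have T_T: "?T (?T x) = x" for x
      using T_inner[of x] by simp
    have T_norm: "norm (?T x) = norm x" for x
    proof -
      have "(norm (?T x))\<^sup>2 = (norm x)\<^sup>2"
        unfolding power2_norm_eq_inner by (simp add: inner_diff_left inner_diff_right ee inner_commute power2_eq_square)
      then show ?thesis by simp
    qed
    have T_K: "?T x \<in> ?K \<longleftrightarrow> x \<in> ?K" for x
      unfolding rev_body_def mem_Collect_eq T_proj T_inner norm_minus_cancel by (rule refl)
    have T_lin: "bounded_linear ?T"
      by (intro bounded_linear_sub bounded_linear_ident bounded_linear_scaleR_const
            bounded_linear_const_mult bounded_linear_inner_left)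
    have T_diff: "?T x - ?T y = ?T (x - y)" for x y
      by (simp add: algebra_simps inner_diff_left)
    have [measurable]: "?T \<in> borel_measurable borel" by measurable
    \<comment> \<open>An isometric involution pulls a ball back to a ball of the same radius, and
      agreement on balls suffices.\<close>
    have T_lborel: "lborel = distr lborel borel ?T"
    proof (rule lborel_eqI_cball)
      fix c :: 'a and \<rho> :: real
      have "?T -` cball c \<rho> = cball (?T c) \<rho>"
      proof -
        have "dist c (?T x) = dist (?T c) x" for x
        proof -
          have "dist c (?T x) = norm (?T (c - ?T x))" by (simp only: T_norm dist_norm)
          also have "\<dots> = norm (?T c - ?T (?T x))" by (simp only: T_diff)
          finally show ?thesis by (simp only: T_T dist_norm)
        qed
        then show ?thesis by (auto simp: mem_cball)
      qed
      then show "emeasure (distr lborel borel ?T) (cball c \<rho>) = emeasure lborel (cball c \<rho>)"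
        if "\<rho> > 0" using that by (simp add: emeasure_distr emeasure_cball)
    qed simp
    have K: "bounded ?K" "?K \<in> sets borel"
      using bounded_rev_body[OF r(1) e] borel_closed[OF closed_rev_body[OF r(1)]] by auto
    note [measurable] = K(2)
    have int: "integrable lborel (\<lambda>x. indicator ?K x *\<^sub>R x)"
      using integrable_onb_lborel[OF B(1,2) _ K, of "\<lambda>x. x"] K by (simp add: lborel continuous_on_id)
    have "(LINT x:?K|lborel. x) = (LINT x|distr lborel borel ?T. indicator ?K x *\<^sub>R x)"
      unfolding set_lebesgue_integral_def T_lborel[symmetric] ..
    also have "\<dots> = (LINT x|lborel. indicator ?K (?T x) *\<^sub>R ?T x)"
      by (subst integral_distr) auto
    also have "\<dots> = (LINT x|lborel. ?T (indicator ?K x *\<^sub>R x))"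
      by (intro Bochner_Integration.integral_cong) (auto simp: T_K split: split_indicator)
    also have "\<dots> = ?T (LINT x:?K|lborel. x)"
      unfolding set_lebesgue_integral_def by (rule integral_bounded_linear[OF T_lin int])
    finally show ?thesis by simp
  qed
  moreover have "v = 0" if "v \<bullet> e = 0" "v = (2 * (v \<bullet> e)) *\<^sub>R e - v" for v
  proof -
    have "v + v = v + ((2 * (v \<bullet> e)) *\<^sub>R e - v)" by (rule arg_cong[OF that(2)])
    then have "2 *\<^sub>R v = 0" by (simp add: that(1) scaleR_2)
    then show ?thesis by simp
  qed
  ultimately have "(LINT x:?K|lborel. x) = 0" by blast
  then show ?thesis by (simp add: centroid_def)
qed

text \<open>In the hyperplane choose \<zeta> along the projection of \<open>e\<close> and complete
  it by \<open>W\<close>. Then \<open>\<zeta> \<bullet> e\<close> is the sine of the angle between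
  \<xi> and \<open>e\<close>, and the parameter of the section moment is the squared
  cotangent.\<close>

lemma rev_body_section_centroid:
  fixes e \<xi> :: "'a::euclidean_space"
  assumes e: "norm e = 1" and \<xi>: "norm \<xi> = 1" "\<xi> \<noteq> e" "\<xi> \<noteq> - e" and dim: "3 \<le> DIM('a)"
    and r: "continuous_on UNIV r" "\<And>t. t \<in> {-a..b} \<Longrightarrow> 0 < r t" and ab: "0 < a" "0 < b"
    and F: "\<And>u. 0 \<le> u \<Longrightarrow> 0 < section_moment (DIM('a) - 2) r (-a) b u"
  shows "0 < centroid (subspace_lborel (perp \<xi>)) (rev_body e r (-a) b \<inter> perp \<xi>) \<bullet> e"
proof -
  let ?K = "rev_body e r (-a) b" and ?M = "subspace_lborel (perp \<xi>)"
  define v where "v = e - (e \<bullet> \<xi>) *\<^sub>R \<xi>"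
  have ee: "e \<bullet> e = 1" "\<xi> \<bullet> \<xi> = 1" using e \<xi> by (simp_all add: norm_eq_1)
  have "v \<noteq> 0"
  proof
    assume "v = 0"
    then have e': "e = (e \<bullet> \<xi>) *\<^sub>R \<xi>" by (simp add: v_def)
    then have "norm e = \<bar>e \<bullet> \<xi>\<bar> * norm \<xi>" by (metis norm_scaleR)
    then have "\<bar>e \<bullet> \<xi>\<bar> = 1" using e \<xi> by simp
    then have "e \<bullet> \<xi> = 1 \<or> e \<bullet> \<xi> = -1" by linarith
    then have "e = \<xi> \<or> e = - \<xi>" using e' by (metis scaleR_minus1_left scaleR_one)
    then show False using \<xi> by auto
  qed
  define \<zeta> where "\<zeta> = (1 / norm v) *\<^sub>R v"
  have v\<xi>: "v \<bullet> \<xi> = 0" by (simp add: v_def inner_diff_left ee)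
  have "v \<bullet> e = v \<bullet> v" by (simp add: v_def inner_diff_left inner_diff_right ee inner_commute)
  then have z: "\<zeta> \<bullet> e = norm v"
    using \<open>v \<noteq> 0\<close> by (simp add: \<zeta>_def dot_square_norm power2_eq_square)
  have \<zeta>: "norm \<zeta> = 1" "\<zeta> \<bullet> \<xi> = 0" using \<open>v \<noteq> 0\<close> v\<xi> by (simp_all add: \<zeta>_def)
  have e_eq: "e = norm v *\<^sub>R \<zeta> + (e \<bullet> \<xi>) *\<^sub>R \<xi>" using \<open>v \<noteq> 0\<close> by (simp add: \<zeta>_def v_def)
  \<comment> \<open>Since \<open>e\<close> lies in the span of \<zeta> and \<xi>, a basis of the
    complement of both is orthogonal to \<open>e\<close>, as \<open>moment_rev_body\<close>
    requires.\<close>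
  have "subspace (perp \<xi> \<inter> perp \<zeta>)" by (intro subspace_inter subspace_perp)
  then obtain W where W: "orthonormal_basis_of (perp \<xi> \<inter> perp \<zeta>) W"
    using orthonormal_basis_of_exists by blast
  have Wsub: "w \<bullet> \<xi> = 0" "w \<bullet> \<zeta> = 0" if "w \<in> W" for w
    using that W span_superset[of W] by (auto simp: orthonormal_basis_of_def perp_def)
  have B: "pairwise orthogonal (insert \<zeta> W)" "\<And>b. b \<in> insert \<zeta> W \<Longrightarrow> norm b = 1"
    using W Wsub \<zeta> by (auto simp: orthonormal_basis_of_def pairwise_insert orthogonal_def inner_commute)
  have "\<zeta> \<notin> W" using Wsub(2)[of \<zeta>] \<zeta> by (auto simp: norm_eq_1)
  have onb: "orthonormal_basis_of (perp \<xi>) (insert \<zeta> W)"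
    unfolding orthonormal_basis_of_def
  proof (intro conjI ballI)
    have "x - (x \<bullet> \<zeta>) *\<^sub>R \<zeta> \<in> span W" if "x \<in> perp \<xi>" for x
    proof -
      have "x - (x \<bullet> \<zeta>) *\<^sub>R \<zeta> \<in> perp \<xi> \<inter> perp \<zeta>"
        using that \<zeta> by (simp add: perp_def inner_diff_left norm_eq_1)
      then show ?thesis using W by (simp add: orthonormal_basis_of_def)
    qed
    then have "perp \<xi> \<subseteq> span (insert \<zeta> W)" by (auto simp: span_insert)
    moreover have "span (insert \<zeta> W) \<subseteq> perp \<xi>"
      using Wsub(1) \<zeta>(2) by (intro span_minimal subspace_perp) (auto simp: perp_def)
    ultimately show "span (insert \<zeta> W) = perp \<xi>" by auto
  qed (use B in auto)
  have card: "card W = DIM('a) - 2" "finite W"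
    using card_orthonormal_basis_of_perp[OF \<xi>(1) onb] \<open>\<zeta> \<notin> W\<close> by auto
  then have "W \<noteq> {}" using dim by auto
  have We: "w \<bullet> e = 0" if "w \<in> W" for w
    using Wsub[OF that] by (subst e_eq) (simp add: inner_add_right)
  have M: "?M = onb_lborel (insert \<zeta> W)" by (rule subspace_lborel_perp[OF \<xi>(1) onb])
  have [measurable]: "?K \<in> sets borel" "perp \<xi> \<in> sets borel"
    by (intro borel_closed closed_rev_body r(1) closed_subspace subspace_perp)+
  have AE: "AE x in ?M. x \<in> perp \<xi>"
    unfolding M onb_lborel_def
  proof (subst AE_distr_iff)
    show "AE f in \<Pi>\<^sub>M b\<in>insert \<zeta> W. lborel. (\<Sum>b\<in>insert \<zeta> W. f b *\<^sub>R b) \<in> perp \<xi>"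
      using Wsub(1) \<zeta>(2) by (intro AE_I2) (auto simp: perp_def inner_sum_left intro!: sum.neutral)
  qed auto
  have z1: "norm v \<le> 1" using Cauchy_Schwarz_ineq2[of \<zeta> e] e \<zeta> z by simp
  \<comment> \<open>The measure is concentrated on the hyperplane, so intersecting with it does not
    change the integral.\<close>
  have "(LINT x:?K \<inter> perp \<xi>|?M. x) = (LINT x:?K|?M. x)"
    unfolding set_lebesgue_integral_def
    using AE by (intro integral_cong_AE) (auto simp: M split: split_indicator)
  moreover have "0 < (LINT x:?K|?M. x) \<bullet> e"
  proof -
    have "0 < section_moment (card W) r (-a) b ((1 - (norm v)\<^sup>2) / (norm v)\<^sup>2)"
      unfolding card(1) using z1 by (intro F) (simp add: abs_square_le_1)
    moreover have "0 < unit_ball_vol (card W)" by simp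
    ultimately show ?thesis
      using moment_rev_body[OF B \<open>\<zeta> \<notin> W\<close> \<open>W \<noteq> {}\<close> e We _ r ab] \<open>v \<noteq> 0\<close>
      by (simp add: M z)
  qed
  ultimately have pos: "0 < (LINT x:?K \<inter> perp \<xi>|?M. x) \<bullet> e" by simp
  \<comment> \<open>Measure zero would turn the factor in \<open>centroid\<close> into the default 1
    / 0 = 0. It is excluded because the integral over a null set would vanish, while the moment is
    positive.\<close>
  have "measure ?M (?K \<inter> perp \<xi>) \<noteq> 0"
  proof
    assume 0: "measure ?M (?K \<inter> perp \<xi>) = 0"
    have "emeasure ?M (?K \<inter> perp \<xi>) < \<infinity>"
      unfolding M using bounded_rev_body[OF r(1) e]
      by (intro emeasure_onb_lborel_finite B) (auto intro: bounded_subset)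
    then have "?K \<inter> perp \<xi> \<in> null_sets ?M"
      using 0 by (intro null_setsI) (auto simp: M measure_eq_0_null_sets emeasure_eq_ennreal_measure)
    then have "(LINT x:?K \<inter> perp \<xi>|?M. x) = 0"
      unfolding set_lebesgue_integral_def
      by (intro integral_eq_zero_AE) (auto dest!: AE_not_in split: split_indicator)
    then show False using pos by simp
  qed
  then have "0 < measure ?M (?K \<inter> perp \<xi>)" using measure_nonneg[of ?M "?K \<inter> perp \<xi>"] by linarith
  then show ?thesis using pos by (simp add: centroid_def)
qed

text \<open>Supplies the equality case, where \<xi> is the axis up to sign. Without integrability
  the Bochner integral takes its default value 0, which gives the same result.\<close>

lemma centroid_perp_inner_self:
  "centroid (subspace_lborel (perp \<xi>)) (K \<inter> perp \<xi>) \<bullet> \<xi> = 0"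
proof (cases "integrable (subspace_lborel (perp \<xi>)) (\<lambda>x. indicator (K \<inter> perp \<xi>) x *\<^sub>R x)")
  case True
  then have "(LINT x:K \<inter> perp \<xi>|subspace_lborel (perp \<xi>). x) \<bullet> \<xi> =
      (LINT x|subspace_lborel (perp \<xi>). (indicator (K \<inter> perp \<xi>) x *\<^sub>R x) \<bullet> \<xi>)"
    unfolding set_lebesgue_integral_def by (intro integral_inner_left[symmetric])
  also have "\<dots> = (LINT x|subspace_lborel (perp \<xi>). 0)"
    by (intro Bochner_Integration.integral_cong) (auto simp: perp_def split: split_indicator)
  finally show ?thesis by (simp add: centroid_def)
next
  case False
  then show ?thesis by (simp add: centroid_def set_lebesgue_integral_def not_integrable_integral_eq)
qed

theorem theorem3:
  fixes k :: "'n::finite"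
  assumes "CARD('n) \<ge> 5"
  shows "\<exists>K :: (real ^ 'n) set.
           convex_body K \<and>
           centroid lborel K = 0 \<and>
           (\<forall>\<xi> \<in> sphere 0 1.
              centroid (subspace_lborel (perp \<xi>)) (K \<inter> perp \<xi>) \<bullet> axis k 1 \<ge> 0 \<and>
              (centroid (subspace_lborel (perp \<xi>)) (K \<inter> perp \<xi>) \<bullet> axis k 1 = 0
                 \<longleftrightarrow> \<xi> = axis k 1 \<or> \<xi> = - axis k 1))"
proof -
  let ?e = "axis k 1 :: real ^ 'n"
  have e: "norm ?e = 1" by simp
  \<comment> \<open>With k = n - 4 the exponents k + 3 and k + 2 are n - 1 for the body and n - 2
    for its sections. Positivity of k is where n \<ge> 5 enters.\<close>
  have pos4: "0 < CARD('n) - 4" using assms by simp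
  obtain r a b where ab: "0 < a" "0 < b" and r: "concave_on UNIV r" "continuous_on UNIV r"
    "\<And>t. t \<in> {-a..b} \<Longrightarrow> 0 < r t"
    and C: "integral {-a..b} (\<lambda>t. t * r t ^ (CARD('n) - 4 + 3)) = 0"
    and F: "\<And>u. 0 \<le> u \<Longrightarrow> 0 < section_moment (CARD('n) - 4 + 2) r (-a) b u"
    by (rule profile_exists[OF pos4]) (rule that)
  have dim: "CARD('n) - 4 + 3 = DIM(real ^ 'n) - 1" "CARD('n) - 4 + 2 = DIM(real ^ 'n) - 2"
    using assms by auto
  let ?K = "rev_body ?e r (-a) b"
  show ?thesis
  proof (intro exI[of _ ?K] conjI ballI)
    show "convex_body ?K" by (rule convex_body_rev_body[OF r(2,1,3) e ab])
    show "centroid lborel ?K = 0"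
      using assms C unfolding dim by (intro rev_body_centroid e r ab) auto
    fix \<xi> :: "real ^ 'n" assume "\<xi> \<in> sphere 0 1"
    then have \<xi>: "norm \<xi> = 1" by simp
    let ?c = "centroid (subspace_lborel (perp \<xi>)) (?K \<inter> perp \<xi>) \<bullet> ?e"
    have pos: "0 < ?c" if "\<xi> \<noteq> ?e" "\<xi> \<noteq> - ?e"
      using assms F that unfolding dim by (intro rev_body_section_centroid e \<xi> r ab) auto
    have zero: "?c = 0" if "\<xi> = ?e \<or> \<xi> = - ?e"
      using centroid_perp_inner_self[of \<xi> ?K] that by auto
    show "0 \<le> ?c" using pos zero by force
    show "?c = 0 \<longleftrightarrow> \<xi> = ?e \<or> \<xi> = - ?e" using pos zero by force
  qed
qed

end
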